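(* If $\mathfrak{w}(z,s)\in s\,\mathbb{C}[[z,s]]$, then the spectral curve of the $W$-Hurwitz problem is given by $$X(z)=\Xi_1(z,S(z)),\qquad y(z)=\Upsilon_1(z,S(z))-\Upsilon_1(z,0),$$ if this is well-defined (i.e. if the time $\beta=1$ flow exists); that is, under the substitution $X=X(z)$, $$\omega_{0,1}(X(z))=y(z)\,\frac{dX(z)}{X(z)}.$$
   Context: **Fock space.** Let $\Lambda=\mathbb{C}[p_1,p_2,\dots]$; for $j>0$ let $J_j=j\,\partial/\partial p_j$ and let $J_{-j}$ be multiplication by $p_j$. For an operator $A$ on $\Lambda$, $\langle A\rangle$ is the constant term of $A\cdot 1$. Let $\varsigma(u)=e^{u/2}-e^{-u/2}$. For $n\in\mathbb{Z}$, $$\mathcal{E}_n(u)=\frac{1}{\varsigma(u)}\sum_{N\ge 0}\frac{1}{N!}\sum_{\substack{j_1,\dots,j_N\in\mathbb{Z}\setminus\{0\}\\ j_1+\dots+j_N=n}}\ \prod_{i=1}^N\frac{\varsigma(j_iu)}{j_i}\ {:}J_{j_1}\cdots J_{j_N}{:}$$ where ${:}\ {:}$ moves all $J_j$ with $j<0$ to the left (the $N=0$ term is $\delta_{n,0}/\varsigma(u)$). For $r\ge 0$, $\mathcal{F}_r^k$ is $r!$ times the coefficient of $u^r$ in $\mathcal{E}_{-k}(u)$. **Cut-and-join operator.** For $k\ge0$ let $w_k(j,\hbar)=\sum_{r\ge0}w_{k,r}(\hbar)j^r$ be such that $w_k(\frac{s}{\hbar},\hbar)\in\hbar^{-1}\mathbb{C}[[s,\hbar^2]]$.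 The cut-and-join operator is $$W=\sum_{l\in\mathbb{Z}+\frac12}\sum_{k=0}^\infty w_k(l+\tfrac k2,\hbar)E_{l+k,l},$$ where the $E_{ij}$ are the standard generators of $\widehat{\mathfrak{a}}_\infty$ (the central extension of infinite matrices indexed by $\mathbb{Z}+\frac12$); on $\Lambda$ it acts as $W=\sum_{k,r\ge0}w_{k,r}(\hbar)\big(\mathcal{F}_r^k-\langle\mathcal{F}_r^k\rangle\big)$. Let $\mathfrak{w}(z,s)\in\mathbb{C}[[z,s]]$ be the leading order: $\sum_{k\ge0}w_k(\frac s\hbar,\hbar)z^k=\frac1\hbar\mathfrak{w}(z,s)+O(\hbar)$. Let $s_1,s_2,\dots$ be numbers or formal variables and $S(z)=\sum_{q\ge1}s_qz^q$. **Multidifferential.** $\omega_{0,1}(X)$ is the coefficient of $\hbar^{-1}$ in $$\omega_1(X)=\sum_{m=1}^\infty X^m\frac{dX}{X}\Big\langle J_m\,e^W\,e^{\sum_{q\ge1}s_q\frac{J_{-q}}{q\hbar}}\Big\rangle .$$ **Flow.** $V_{\mathfrak{w}}=(z\partial_z\mathfrak{w})\,\partial_s-(\partial_s\mathfrak{w})\,z\partial_z$ is the Hamiltonian vector field of $\mathfrak{w}$ for the symplectic form $\Omega=\frac{dz}{z}\wedge ds$ on $\mathbb{C}^*\times\mathbb{C}$, and $\Xi_\beta(z,s)=e^{\beta V_{\mathfrak{w}}}z$, $\Upsilon_\beta(z,s)=e^{\beta V_{\mathfrak{w}}}s$ (formal power series in $z,s,\beta$; $\Xi_1,\Upsilon_1$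 denote $\beta=1$ when defined). *)

theory Defs
  imports
    "HOL-Analysis.Analysis"
    "HOL-Library.Poly_Mapping"
    "HOL-Computational_Algebra.Formal_Laurent_Series"
begin

section \<open>The Fock space\<close>

text \<open>Exponent \<open>i\<close> of a monomial is the exponent of \<open>p\<^bsub>i+1\<^esub>\<close>, so that the type \<open>fock\<close> below
  is exactly \<open>\<complex>[p\<^sub>1, p\<^sub>2, \<dots>]\<close>.\<close>

type_synonym mon = "nat \<Rightarrow>\<^sub>0 nat"
type_synonym fock = "mon \<Rightarrow>\<^sub>0 complex"

definition p_mon :: "nat \<Rightarrow> mon" where
  "p_mon j = Poly_Mapping.single (j - 1) 1"

definition p_deriv :: "nat \<Rightarrow> fock \<Rightarrow> fock" where
  "p_deriv j f = (\<Sum>\<mu>\<in>Poly_Mapping.keys f.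
     Poly_Mapping.single (\<mu> - p_mon j)
       (of_nat (Poly_Mapping.lookup \<mu> (j - 1)) * Poly_Mapping.lookup f \<mu>))"

text \<open>Only \<open>j \<noteq> 0\<close> is ever used.\<close>

definition J :: "int \<Rightarrow> fock \<Rightarrow> fock" where
  "J j f = (if j > 0 then of_nat (nat j) * p_deriv (nat j) f
            else Poly_Mapping.single (p_mon (nat (- j))) 1 * f)"

definition normal_ordered :: "int list \<Rightarrow> fock \<Rightarrow> fock" where
  "normal_ordered js =
     foldr (\<lambda>j A. J j \<circ> A) (filter (\<lambda>j. j < 0) js @ filter (\<lambda>j. j > 0) js) id"


section \<open>Matrices over the monomial basis\<close>

text \<open>Operators with coefficients in Laurent series, possibly mapping into the completion of the
  Fock space, are represented by their matrices: \<open>A \<nu> \<mu>\<close> is the coefficient of the monomial \<open>\<nu>\<close> in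
  the image of the monomial \<open>\<mu>\<close>. In particular \<open>A 0 0\<close> is the vacuum expectation. \<open>Sum_any\<close> is
  the sum of a family of finite support; the families occurring below have finite support for degree
  reasons and, in \<open>cut_join\<close>, because a fixed power of \<open>\<hbar>\<close> only meets finitely many \<open>r\<close>.\<close>

type_synonym 'r fmat = "mon \<Rightarrow> mon \<Rightarrow> 'r"

definition mat_of :: "(fock \<Rightarrow> fock) \<Rightarrow> complex fmat" where
  "mat_of A \<nu> \<mu> = Poly_Mapping.lookup (A (Poly_Mapping.single \<mu> 1)) \<nu>"

definition fmat_one :: "'r::comm_ring_1 fmat" where
  "fmat_one \<nu> \<mu> = (if \<nu> = \<mu> then 1 else 0)"

definition fmat_mult :: "'r::comm_ring_1 fmat \<Rightarrow> 'r fmat \<Rightarrow> 'r fmat" where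
  "fmat_mult A B \<nu> \<mu> = Sum_any (\<lambda>\<kappa>. A \<nu> \<kappa> * B \<kappa> \<mu>)"

primrec fmat_power :: "'r::comm_ring_1 fmat \<Rightarrow> nat \<Rightarrow> 'r fmat" where
  "fmat_power A 0 = fmat_one"
| "fmat_power A (Suc n) = fmat_mult A (fmat_power A n)"

text \<open>Exponential of a matrix over complex Laurent series in \<open>\<hbar>\<close>: every coefficient of every entry
  is a convergent series of complex numbers.\<close>

definition fmat_exp :: "complex fls fmat \<Rightarrow> complex fls fmat" where
  "fmat_exp A \<nu> \<mu> = Abs_fls (\<lambda>n. suminf (\<lambda>i. fls_nth (fmat_power A i \<nu> \<mu>) n / fact i))"

text \<open>Exponential of a matrix all of whose entries are killed by high powers (multiplication by a
  series in the \<open>p\<^sub>q\<close> without constant term): no convergence is involved, and the scalars may be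
  arbitrary.\<close>

definition fmat_exp_nil :: "'k::field fls fmat \<Rightarrow> 'k fls fmat" where
  "fmat_exp_nil A \<nu> \<mu> = Sum_any (\<lambda>i. fls_const (1 / of_nat (fact i)) * fmat_power A i \<nu> \<mu>)"


section \<open>The operators \<open>\<E>\<^sub>n(u)\<close> and the cut-and-join operator\<close>

text \<open>\<open>varsig j\<close> is \<open>\<sigma>(j u)\<close> as a series in \<open>u\<close>, where \<open>\<sigma>(u) = exp (u/2) - exp (-u/2)\<close>.\<close>

definition varsig :: "int \<Rightarrow> complex fls" where
  "varsig j = fps_to_fls (fps_exp (of_int j / 2) - fps_exp (- (of_int j / 2)))"

text \<open>The sum over \<open>N\<close> and over \<open>(j\<^sub>1, \<dots>, j\<^sub>N)\<close> is a sum over lists.\<close>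

definition bosE :: "int \<Rightarrow> complex fls fmat" where
  "bosE n \<nu> \<mu> = inverse (varsig 1) *
     Sum_any (\<lambda>js. if 0 \<notin> set js \<and> sum_list js = n
       then fls_const (1 / fact (length js))
            * (\<Prod>j\<leftarrow>js. varsig j * fls_const (1 / of_int j))
            * fls_const (mat_of (normal_ordered js) \<nu> \<mu>)
       else 0)"

definition Fop :: "nat \<Rightarrow> nat \<Rightarrow> complex fmat" where
  "Fop r k \<nu> \<mu> = fact r * fls_nth (bosE (- int k) \<nu> \<mu>) (int r)"

text \<open>The family \<open>w\<close> stores \<open>w\<^bsub>k,r\<^esub>(\<hbar>)\<close> as \<open>w k r\<close>, and \<open>cut_join w\<close> is the matrix of
  \<open>\<Sum>\<^bsub>k,r\<^esub> w\<^bsub>k,r\<^esub>(\<hbar>) (F\<^sub>r\<^sup>k - \<langle>F\<^sub>r\<^sup>k\<rangle>)\<close>, given one power of \<open>\<hbar>\<close> at a time.\<close>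

definition cut_join :: "(nat \<Rightarrow> nat \<Rightarrow> complex fls) \<Rightarrow> complex fls fmat" where
  "cut_join w \<nu> \<mu> = Abs_fls (\<lambda>n. Sum_any (\<lambda>(k, r).
     fls_nth (w k r) n * (Fop r k \<nu> \<mu> - Fop r k 0 0 * fmat_one \<nu> \<mu>)))"

text \<open>\<open>w\<^sub>k(s/\<hbar>, \<hbar>)\<close> as a power series in \<open>s\<close> over Laurent series in \<open>\<hbar>\<close>; \<open>fls_shift r\<close> divides by
  \<open>\<hbar>\<^sup>r\<close>.\<close>

definition scaled_symbol :: "(nat \<Rightarrow> nat \<Rightarrow> complex fls) \<Rightarrow> nat \<Rightarrow> complex fls fps" where
  "scaled_symbol w k = Abs_fps (\<lambda>r. fls_shift (int r) (w k r))"

text \<open>\<open>w\<^sub>k(s/\<hbar>, \<hbar>) \<in> \<hbar>\<^sup>-\<^sup>1 \<complex>[[s, \<hbar>\<^sup>2]]\<close> for all \<open>k\<close>.\<close>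

definition cut_join_symbol :: "(nat \<Rightarrow> nat \<Rightarrow> complex fls) \<Rightarrow> bool" where
  "cut_join_symbol w \<longleftrightarrow>
     (\<forall>k r n. fls_nth (fps_nth (scaled_symbol w k) r) n \<noteq> 0 \<longrightarrow> (\<exists>i::nat. n = 2 * int i - 1))"


section \<open>Power series in \<open>z\<close> and \<open>s\<close>, and the Hamiltonian flow\<close>

text \<open>\<open>\<complex>[[z,s]]\<close> is \<open>\<complex>[[z]][[s]]\<close>: the outer variable is \<open>s\<close>, the inner one is \<open>z\<close>.\<close>

type_synonym series_zs = "complex fps fps"

definition var_z :: series_zs where "var_z = fps_const fps_X"

definition var_s :: series_zs where "var_s = fps_X"

definition d_s :: "series_zs \<Rightarrow> series_zs" where "d_s f = fps_deriv f"

definition zd_z :: "series_zs \<Rightarrow> series_zs" where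
  "zd_z f = Abs_fps (\<lambda>b. fps_XD (fps_nth f b))"

definition leading_symbol :: "(nat \<Rightarrow> nat \<Rightarrow> complex fls) \<Rightarrow> series_zs" where
  "leading_symbol w =
     Abs_fps (\<lambda>r. Abs_fps (\<lambda>k. fls_nth (fps_nth (scaled_symbol w k) r) (- 1)))"

definition ham_field :: "series_zs \<Rightarrow> series_zs \<Rightarrow> series_zs" where
  "ham_field h f = zd_z h * d_s f - d_s h * zd_z f"

text \<open>\<open>exp (\<beta> V\<^sub>h) f\<close> as a power series in \<open>\<beta>\<close> over \<open>\<complex>[[z,s]]\<close>; its value at \<open>\<beta> = 1\<close>, when it exists,
  is taken coefficient by coefficient in \<open>z\<close> and \<open>s\<close>.\<close>

definition flow :: "series_zs \<Rightarrow> series_zs \<Rightarrow> series_zs fps" where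
  "flow h f = Abs_fps (\<lambda>n. fps_const (fps_const (1 / fact n)) * (ham_field h ^^ n) f)"

definition time1_exists :: "series_zs fps \<Rightarrow> bool" where
  "time1_exists F \<longleftrightarrow> (\<forall>a b. summable (\<lambda>n. fps_nth (fps_nth (fps_nth F n) b) a))"

definition time1 :: "series_zs fps \<Rightarrow> series_zs" where
  "time1 F = Abs_fps (\<lambda>b. Abs_fps (\<lambda>a. suminf (\<lambda>n. fps_nth (fps_nth (fps_nth F n) b) a)))"

definition Xi :: "series_zs \<Rightarrow> series_zs fps" where "Xi h = flow h var_z"

definition Upsilon :: "series_zs \<Rightarrow> series_zs fps" where "Upsilon h = flow h var_s"


section \<open>Numbers or formal variables \<open>s\<^sub>q\<close>\<close>

text \<open>The \<open>s\<^sub>q\<close> are elements of a field \<open>'k\<close> containing the complex numbers through \<open>\<iota>\<close>: \<open>'k\<close> is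
  \<open>complex\<close> and \<open>\<iota>\<close> the identity when they are numbers, and the field of fractions of
  \<open>\<complex>[s\<^sub>1, s\<^sub>2, \<dots>]\<close> when they are formal variables.\<close>

definition field_embedding :: "(complex \<Rightarrow> 'k::field) \<Rightarrow> bool" where
  "field_embedding \<iota> \<longleftrightarrow> \<iota> 1 = 1 \<and> (\<forall>a b. \<iota> (a + b) = \<iota> a + \<iota> b) \<and> (\<forall>a b. \<iota> (a * b) = \<iota> a * \<iota> b)"

definition fps_map :: "(complex \<Rightarrow> 'k::field) \<Rightarrow> complex fps \<Rightarrow> 'k fps" where
  "fps_map \<iota> f = Abs_fps (\<lambda>n. \<iota> (fps_nth f n))"

definition fls_map :: "(complex \<Rightarrow> 'k::field) \<Rightarrow> complex fls \<Rightarrow> 'k fls" where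
  "fls_map \<iota> f = Abs_fls (\<lambda>n. \<iota> (fls_nth f n))"

definition S_series :: "(nat \<Rightarrow> 'k::field) \<Rightarrow> 'k fps" where
  "S_series s = Abs_fps (\<lambda>q. if q = 0 then 0 else s q)"

text \<open>\<open>f(z, S(z))\<close> for \<open>S\<close> without constant term, as for \<open>fps_compose\<close>.\<close>

definition subst_s :: "(complex \<Rightarrow> 'k::field) \<Rightarrow> series_zs \<Rightarrow> 'k fps \<Rightarrow> 'k fps" where
  "subst_s \<iota> f S = Abs_fps (\<lambda>n. \<Sum>b\<le>n. fps_nth (fps_map \<iota> (fps_nth f b) * S ^ b) n)"

definition X_curve :: "(complex \<Rightarrow> 'k::field) \<Rightarrow> series_zs \<Rightarrow> (nat \<Rightarrow> 'k) \<Rightarrow> 'k fps" where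
  "X_curve \<iota> h s = subst_s \<iota> (time1 (Xi h)) (S_series s)"

definition y_curve :: "(complex \<Rightarrow> 'k::field) \<Rightarrow> series_zs \<Rightarrow> (nat \<Rightarrow> 'k) \<Rightarrow> 'k fps" where
  "y_curve \<iota> h s = subst_s \<iota> (time1 (Upsilon h)) (S_series s) - subst_s \<iota> (time1 (Upsilon h)) 0"


section \<open>The multidifferential \<open>\<omega>\<^sub>0\<^sub>,\<^sub>1\<close>\<close>

text \<open>Matrix of \<open>\<Sum>\<^sub>q\<^sub>\<ge>\<^sub>1 s\<^sub>q J\<^sub>-\<^sub>q / (q \<hbar>)\<close>.\<close>

definition source :: "(complex \<Rightarrow> 'k::field) \<Rightarrow> (nat \<Rightarrow> 'k) \<Rightarrow> 'k fls fmat" where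
  "source \<iota> s \<nu> \<mu> = Sum_any (\<lambda>q. if q \<ge> 1
     then fls_const (s q / of_nat q) * fls_X_inv * fls_const (\<iota> (mat_of (J (- int q)) \<nu> \<mu>))
     else 0)"

definition correlator ::
    "(complex \<Rightarrow> 'k::field) \<Rightarrow> (nat \<Rightarrow> nat \<Rightarrow> complex fls) \<Rightarrow> (nat \<Rightarrow> 'k) \<Rightarrow> nat \<Rightarrow> 'k fls" where
  "correlator \<iota> w s m =
     fmat_mult (\<lambda>\<nu> \<mu>. fls_const (\<iota> (mat_of (J (int m)) \<nu> \<mu>)))
       (fmat_mult (\<lambda>\<nu> \<mu>. fls_map \<iota> (fmat_exp (cut_join w) \<nu> \<mu>))
         (fmat_exp_nil (source \<iota> s))) 0 0"

text \<open>\<open>\<omega>\<^sub>0\<^sub>,\<^sub>1(X) = omega01 (X) dX/X\<close>.\<close>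

definition omega01 ::
    "(complex \<Rightarrow> 'k::field) \<Rightarrow> (nat \<Rightarrow> nat \<Rightarrow> complex fls) \<Rightarrow> (nat \<Rightarrow> 'k) \<Rightarrow> 'k fps" where
  "omega01 \<iota> w s = Abs_fps (\<lambda>m. if m = 0 then 0 else fls_nth (correlator \<iota> w s m) (- 1))"

text \<open>The coefficient of \<open>dz\<close> in \<open>dX(z)/X(z)\<close>.\<close>

definition dlog :: "'k::field fps \<Rightarrow> 'k fls" where
  "dlog X = fps_to_fls (fps_deriv X) / fps_to_fls X"

end

theory Submission
  imports Defs
begin

text \<open>
  Let \<open>\<hbar>\<close> and every \<open>p\<^sub>j\<close> have weight \<open>1\<close>. Then the matrix entries of the cut-and-join operator have no
  part of negative weight, and its part of weight \<open>0\<close> consists of terms that create exactly one \<open>p\<^sub>j\<close>.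
  With respect to the Hall inner product it is the adjoint of a derivation \<open>D\<close> of the Fock space, namely
  \<open>D p\<^sub>m = m [z\<^sup>m] \<ww>(z, P(z))\<close> with \<open>P(z) = \<Sum>\<^sub>m p\<^sub>m z\<^sup>m\<close>. Pairing with the exponential source evaluates
  at \<open>p\<^sub>q = s\<^sub>q\<close>, so the coefficient of \<open>X\<^sup>m\<close> in \<open>\<omega>\<^sub>0\<^sub>,\<^sub>1\<close> is the value of \<open>exp(D) p\<^sub>m\<close> there.

  Extend \<open>D\<close> coefficientwise to power series in \<open>z\<close> and put \<open>D' = D - (\<partial>\<^sub>s\<ww>)(z, P(z)) z\<partial>\<^sub>z\<close>. The chain rule
  shows that substitution of \<open>P(z)\<close> for \<open>s\<close> intertwines the Hamiltonian vector field with \<open>D'\<close>. Since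
  \<open>D'\<close> is a derivation, \<open>exp(D')\<close> is a ring homomorphism; it satisfies \<open>exp(D') z = \<Xi>(z, P(z))\<close> and \<open>exp(D') P = \<Upsilon>(z, P(z))\<close>,
  and applying it to \<open>P(z) = \<Sum>\<^sub>m p\<^sub>m z\<^sup>m\<close> gives \<open>\<Upsilon> = \<Sum>\<^sub>m exp(D)(p\<^sub>m) \<Xi>\<^sup>m\<close>, which becomes
  \<open>y = \<omega>\<^sub>0\<^sub>,\<^sub>1(X)\<close> at \<open>p\<^sub>q = s\<^sub>q\<close>. Finally \<open>\<Upsilon>(z, 0) = 0\<close> because the flow preserves the ideal \<open>(s)\<close>.
\<close>

section \<open>Finitely supported functions as sums of single terms\<close>

lemma poly_mapping_expansion:
  fixes f :: "'a \<Rightarrow>\<^sub>0 'b::comm_monoid_add"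
  shows "f = (\<Sum>x\<in>Poly_Mapping.keys f. Poly_Mapping.single x (Poly_Mapping.lookup f x))"
  by (rule poly_mapping_eqI) (auto simp: lookup_sum lookup_single when_def in_keys_iff)

lemma fock_induct [case_names zero single add]:
  fixes f :: "'a \<Rightarrow>\<^sub>0 'b::comm_monoid_add"
  assumes "P 0" "\<And>x c. P (Poly_Mapping.single x c)" "\<And>f g. P f \<Longrightarrow> P g \<Longrightarrow> P (f + g)"
  shows "P f"
proof -
  have "P (\<Sum>x\<in>A. Poly_Mapping.single x (Poly_Mapping.lookup f x))" if "finite A" for A
    using that by induction (use assms in auto)
  thus ?thesis using poly_mapping_expansion[of f] finite_keys by metis
qed

section \<open>Monomials\<close>

lemma prod_keys_superset:
  fixes g :: "'a \<Rightarrow> nat \<Rightarrow> 'b::comm_monoid_mult"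
  assumes "\<And>i. g i 0 = 1" "finite A" "Poly_Mapping.keys \<mu> \<subseteq> A"
  shows "(\<Prod>i\<in>Poly_Mapping.keys \<mu>. g i (Poly_Mapping.lookup \<mu> i)) = (\<Prod>i\<in>A. g i (Poly_Mapping.lookup \<mu> i))"
  using assms by (intro prod.mono_neutral_left) (auto simp: in_keys_iff)

text \<open>Index \<open>i\<close> stands for the variable with number \<open>i + 1\<close>; the
  factor \<open>Suc i\<close> gives p_j degree j, so this is the size of the partition behind the
  monomial, and \<open>mlen\<close> below is its length.\<close>

definition mdeg :: "mon \<Rightarrow> nat" where
  "mdeg \<mu> = (\<Sum>i\<in>Poly_Mapping.keys \<mu>. Suc i * Poly_Mapping.lookup \<mu> i)"

definition mlen :: "mon \<Rightarrow> nat" where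
  "mlen \<mu> = (\<Sum>i\<in>Poly_Mapping.keys \<mu>. Poly_Mapping.lookup \<mu> i)"

definition mval :: "(nat \<Rightarrow> 'a::comm_monoid_mult) \<Rightarrow> mon \<Rightarrow> 'a" where
  "mval x \<mu> = (\<Prod>i\<in>Poly_Mapping.keys \<mu>. x (Suc i) ^ Poly_Mapping.lookup \<mu> i)"

definition mfact :: "mon \<Rightarrow> nat" where
  "mfact \<mu> = (\<Prod>i\<in>Poly_Mapping.keys \<mu>. fact (Poly_Mapping.lookup \<mu> i))"

text \<open>The squared norm of \<open>p\<^sub>\<mu>\<close> for the Hall inner product.\<close>

definition mz :: "mon \<Rightarrow> complex" where
  "mz \<mu> = of_nat (mval id \<mu> * mfact \<mu>)"

lemma mdeg_superset: "finite A \<Longrightarrow> Poly_Mapping.keys \<mu> \<subseteq> A \<Longrightarrow> mdeg \<mu> = (\<Sum>i\<in>A. Suc i * Poly_Mapping.lookup \<mu> i)"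
  unfolding mdeg_def by (intro sum.mono_neutral_left) (auto simp: in_keys_iff)

lemma mlen_superset: "finite A \<Longrightarrow> Poly_Mapping.keys \<mu> \<subseteq> A \<Longrightarrow> mlen \<mu> = (\<Sum>i\<in>A. Poly_Mapping.lookup \<mu> i)"
  unfolding mlen_def by (intro sum.mono_neutral_left) (auto simp: in_keys_iff)

lemma keys_add_nat: "Poly_Mapping.keys (\<mu> + \<nu> :: mon) = Poly_Mapping.keys \<mu> \<union> Poly_Mapping.keys \<nu>"
  by (auto simp: in_keys_iff lookup_add)

lemma mdeg_add: "mdeg (\<mu> + \<nu>) = mdeg \<mu> + mdeg \<nu>"
proof -
  let ?A = "Poly_Mapping.keys \<mu> \<union> Poly_Mapping.keys \<nu>"
  show ?thesis
    by (subst (1 2 3) mdeg_superset[of ?A])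
       (auto simp: keys_add_nat lookup_add algebra_simps sum.distrib)
qed

lemma mlen_add: "mlen (\<mu> + \<nu>) = mlen \<mu> + mlen \<nu>"
proof -
  let ?A = "Poly_Mapping.keys \<mu> \<union> Poly_Mapping.keys \<nu>"
  show ?thesis
    by (subst (1 2 3) mlen_superset[of ?A])
       (auto simp: keys_add_nat lookup_add algebra_simps sum.distrib)
qed

lemma mval_add: "mval x (\<mu> + \<nu>) = mval x \<mu> * mval x \<nu>"
proof -
  let ?A = "Poly_Mapping.keys \<mu> \<union> Poly_Mapping.keys \<nu>"
  show ?thesis unfolding mval_def
    by (subst (1 2 3) prod_keys_superset[of "\<lambda>i n. x (Suc i) ^ n" ?A])
       (auto simp: keys_add_nat lookup_add power_add prod.distrib)
qed

lemma mdeg_0 [simp]: "mdeg 0 = 0" and mlen_0 [simp]: "mlen 0 = 0"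
  and mval_0 [simp]: "mval x 0 = 1" and mfact_0 [simp]: "mfact 0 = 1" and mz_0 [simp]: "mz 0 = 1"
  by (simp_all add: mdeg_def mlen_def mval_def mfact_def mz_def)

lemma lookup_p_mon: "Poly_Mapping.lookup (p_mon j) i = (if i = j - 1 then 1 else 0)"
  by (auto simp: p_mon_def lookup_single when_def)

lemma p_mon_inject: "i \<ge> 1 \<Longrightarrow> j \<ge> 1 \<Longrightarrow> p_mon i = p_mon j \<longleftrightarrow> i = j"
  by (metis lookup_p_mon Suc_pred' Suc_le_eq One_nat_def zero_neq_one)

lemma keys_p_mon [simp]: "Poly_Mapping.keys (p_mon j) = {j - 1}"
  by (simp add: p_mon_def)

lemma mdeg_p_mon: "j \<ge> 1 \<Longrightarrow> mdeg (p_mon j) = j" and mlen_p_mon [simp]: "mlen (p_mon j) = 1"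
  and mval_p_mon: "j \<ge> 1 \<Longrightarrow> mval x (p_mon j) = x j"
  and mfact_p_mon [simp]: "mfact (p_mon j) = 1"
  by (simp_all add: mdeg_def mlen_def mval_def mfact_def lookup_p_mon)

lemma mz_p_mon: "j \<ge> 1 \<Longrightarrow> mz (p_mon j) = of_nat j"
  by (simp add: mz_def mval_p_mon)

lemma mfact_add_p_mon: "mfact (\<mu> + p_mon j) = (Poly_Mapping.lookup \<mu> (j - 1) + 1) * mfact \<mu>"
proof -
  let ?A = "insert (j - 1) (Poly_Mapping.keys \<mu>)"
  have "mfact (\<mu> + p_mon j) = (\<Prod>i\<in>?A. fact (Poly_Mapping.lookup \<mu> i + (if i = j - 1 then 1 else 0)))"
    unfolding mfact_def
    by (subst prod_keys_superset[of "\<lambda>i. fact" ?A]) (auto simp: keys_add_nat lookup_add lookup_p_mon)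
  also have "\<dots> = (\<Prod>i\<in>?A. (if i = j - 1 then Poly_Mapping.lookup \<mu> i + 1 else 1) * fact (Poly_Mapping.lookup \<mu> i))"
    by (intro prod.cong) auto
  also have "\<dots> = (Poly_Mapping.lookup \<mu> (j - 1) + 1) * mfact \<mu>"
    unfolding mfact_def prod.distrib
    by (subst prod_keys_superset[of "\<lambda>i. fact" ?A "\<mu>"]) auto
  finally show ?thesis .
qed

lemma mz_add_p_mon:
  "j \<ge> 1 \<Longrightarrow> mz (\<mu> + p_mon j) = of_nat (j * (Poly_Mapping.lookup \<mu> (j - 1) + 1)) * mz \<mu>"
  by (simp add: mz_def mfact_add_p_mon mval_add mval_p_mon algebra_simps)

lemma mfact_nonzero [simp]: "mfact \<mu> \<noteq> 0"
  by (simp add: mfact_def)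

lemma mz_nonzero [simp]: "mz \<mu> \<noteq> 0"
  unfolding mz_def of_nat_eq_0_iff by (auto simp: mval_def)

lemma p_mon_split: "Poly_Mapping.lookup \<mu> (j - 1) \<noteq> 0 \<Longrightarrow> \<mu> = (\<mu> - p_mon j) + p_mon j"
  by (rule poly_mapping_eqI) (auto simp: lookup_add lookup_minus lookup_p_mon)

lemma lookup_le_mdeg: "Suc i * Poly_Mapping.lookup \<mu> i \<le> mdeg \<mu>"
proof (cases "i \<in> Poly_Mapping.keys \<mu>")
  case True thus ?thesis unfolding mdeg_def by (intro member_le_sum) auto
qed (simp add: in_keys_iff)

lemma mon_cases:
  obtains "\<mu> = 0" | \<nu> j where "j \<ge> 1" "\<mu> = \<nu> + p_mon j"
proof (cases "\<mu> = 0")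
  case False
  then obtain i where "Poly_Mapping.lookup \<mu> i \<noteq> 0" by (metis poly_mapping_eqI lookup_zero)
  thus ?thesis using p_mon_split[of \<mu> "Suc i"] that(2)[of "Suc i" "\<mu> - p_mon (Suc i)"] by simp
qed (use that in auto)

text \<open>Removing a variable p_j from a nonzero monomial of degree at most d leaves one of degree
  at most d - j, so strong induction applies. These finite sets later carry the matrix products with
  \<open>cut_join w\<close>.\<close>

lemma finite_mdeg_le: "finite {\<mu>. mdeg \<mu> \<le> d}"
proof (induction d rule: less_induct)
  case (less d)
  have "{\<mu>. mdeg \<mu> \<le> d} \<subseteq> insert 0 (\<Union>j\<in>{1..d}. (\<lambda>\<mu>. \<mu> + p_mon j) ` {\<mu>. mdeg \<mu> \<le> d - j})"
  proof
    fix \<mu> assume \<mu>: "\<mu> \<in> {\<mu>. mdeg \<mu> \<le> d}"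
    show "\<mu> \<in> insert 0 (\<Union>j\<in>{1..d}. (\<lambda>\<mu>. \<mu> + p_mon j) ` {\<mu>. mdeg \<mu> \<le> d - j})"
    proof (cases \<mu> rule: mon_cases)
      case (2 \<nu> j)
      with \<mu> have "j \<in> {1..d}" "\<nu> \<in> {\<mu>. mdeg \<mu> \<le> d - j}" by (auto simp: mdeg_add mdeg_p_mon)
      with 2 show ?thesis by blast
    qed (use \<mu> in auto)
  qed
  moreover have "finite \<dots>" using less by auto
  ultimately show ?case by (rule finite_subset)
qed

section \<open>The operators \<open>J\<^sub>j\<close> and the Hall inner product\<close>

lemma p_deriv_superset:
  assumes "finite A" "Poly_Mapping.keys f \<subseteq> A"
  shows "p_deriv j f = (\<Sum>\<mu>\<in>A. Poly_Mapping.single (\<mu> - p_mon j)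
       (of_nat (Poly_Mapping.lookup \<mu> (j - 1)) * Poly_Mapping.lookup f \<mu>))"
  unfolding p_deriv_def using assms by (intro sum.mono_neutral_left) (auto simp: in_keys_iff)

lemma p_deriv_add: "p_deriv j (f + g) = p_deriv j f + p_deriv j g"
proof -
  let ?A = "Poly_Mapping.keys f \<union> Poly_Mapping.keys g"
  have "Poly_Mapping.keys (f + g) \<subseteq> ?A" by (rule keys_add)
  thus ?thesis
    by (subst (1 2 3) p_deriv_superset[of ?A])
       (auto simp: lookup_add algebra_simps single_add sum.distrib)
qed

lemma p_deriv_single:
  "p_deriv j (Poly_Mapping.single \<mu> c) =
     Poly_Mapping.single (\<mu> - p_mon j) (of_nat (Poly_Mapping.lookup \<mu> (j - 1)) * c)"
  by (subst p_deriv_superset[of "{\<mu>}"]) auto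

lemma J_pos_single:
  "j > 0 \<Longrightarrow> J (int j) (Poly_Mapping.single \<mu> c) =
     Poly_Mapping.single (\<mu> - p_mon j) (of_nat (j * Poly_Mapping.lookup \<mu> (j - 1)) * c)"
  by (simp add: J_def p_deriv_single mult_single algebra_simps flip: single_of_nat)

lemma J_neg_single:
  "J (- int j) (Poly_Mapping.single \<mu> c) = Poly_Mapping.single (\<mu> + p_mon j) c"
  by (simp add: J_def mult_single algebra_simps)

lemma J_add: "J j (f + g) = J j f + J j g"
  by (simp add: J_def p_deriv_add algebra_simps)

lemma p_deriv_0 [simp]: "p_deriv j 0 = 0"
  by (simp add: p_deriv_def)

lemma J_0 [simp]: "J j 0 = 0"
  by (simp add: J_def)

lemma p_deriv_mult: "p_deriv j (f * g) = p_deriv j f * g + f * p_deriv j g"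
proof (induction f rule: fock_induct)
  case (single x c)
  show ?case
  proof (induction g rule: fock_induct)
    case (single y d)
    define i where "i = j - 1"
    \<comment> \<open>Exponents are subtracted with truncation at 0, so \<open>- p_mon j\<close> may
      be moved onto \<open>x\<close> only when p_j occurs in it; otherwise the derivative of
      \<open>x\<close> has coefficient 0.\<close>
    have *: "x + y - p_mon j = (x - p_mon j) + y" if "Poly_Mapping.lookup x i \<noteq> 0" for x y :: mon
      using that by (intro poly_mapping_eqI) (auto simp: lookup_add lookup_minus lookup_p_mon i_def)
    show ?case
      using *[of x y] *[of y x]
      by (cases "Poly_Mapping.lookup x i = 0"; cases "Poly_Mapping.lookup y i = 0")
         (auto simp: p_deriv_single mult_single lookup_add algebra_simps i_def simp flip: single_add)
  qed (auto simp: p_deriv_add algebra_simps)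
qed (auto simp: p_deriv_add algebra_simps)

lemma J_pos_mult: "j > 0 \<Longrightarrow> J j (f * g) = J j f * g + f * J j g"
  by (simp add: J_def p_deriv_mult algebra_simps)

definition Jlist :: "int list \<Rightarrow> fock \<Rightarrow> fock" where
  "Jlist js = foldr (\<lambda>j A. J j \<circ> A) js id"

lemma Jlist_Nil [simp]: "Jlist [] f = f" and Jlist_Cons [simp]: "Jlist (j # js) f = J j (Jlist js f)"
  by (simp_all add: Jlist_def)

lemma Jlist_append: "Jlist (xs @ ys) f = Jlist xs (Jlist ys f)"
  by (induction xs) auto

lemma Jlist_0 [simp]: "Jlist js 0 = 0"
  by (induction js) auto

lemma normal_ordered_eq: "normal_ordered js = Jlist (filter (\<lambda>j. j < 0) js @ filter (\<lambda>j. j > 0) js)"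
  by (simp add: normal_ordered_def Jlist_def)

text \<open>The monomials are orthogonal with squared norm \<open>mz\<close>. The form is bilinear,
  without complex conjugation, so adjoints are transposes up to the weights
  \<open>mz\<close>.\<close>

definition hall :: "fock \<Rightarrow> fock \<Rightarrow> complex" where
  "hall f g = (\<Sum>\<mu>\<in>Poly_Mapping.keys f. mz \<mu> * Poly_Mapping.lookup f \<mu> * Poly_Mapping.lookup g \<mu>)"

lemma hall_superset:
  "finite A \<Longrightarrow> Poly_Mapping.keys f \<subseteq> A \<Longrightarrow> hall f g = (\<Sum>\<mu>\<in>A. mz \<mu> * Poly_Mapping.lookup f \<mu> * Poly_Mapping.lookup g \<mu>)"
  unfolding hall_def by (intro sum.mono_neutral_left) (auto simp: in_keys_iff)

lemma hall_add_left: "hall (f + g) h = hall f h + hall g h"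
proof -
  let ?A = "Poly_Mapping.keys f \<union> Poly_Mapping.keys g"
  have "Poly_Mapping.keys (f + g) \<subseteq> ?A" by (rule keys_add)
  thus ?thesis
    by (subst (1 2 3) hall_superset[of ?A]) (auto simp: lookup_add algebra_simps sum.distrib)
qed

lemma hall_add_right: "hall f (g + h) = hall f g + hall f h"
  by (simp add: hall_def lookup_add algebra_simps sum.distrib)

lemma hall_0 [simp]: "hall 0 g = 0" "hall f 0 = 0"
  by (simp_all add: hall_def)

lemma hall_single: "hall (Poly_Mapping.single \<mu> c) g = mz \<mu> * c * Poly_Mapping.lookup g \<mu>"
  by (subst hall_superset[of "{\<mu>}"]) auto

lemma hall_single_right: "hall f (Poly_Mapping.single \<mu> c) = mz \<mu> * c * Poly_Mapping.lookup f \<mu>"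
  by (induction f rule: fock_induct)
     (auto simp: hall_add_left hall_single lookup_add lookup_single when_def algebra_simps)

text \<open>Multiplying a monomial by p_j multiplies \<open>mz\<close> by j times the new exponent
  (\<open>mz_add_p_mon\<close>), which is the very factor produced by j d/dp_j.\<close>

lemma J_adjoint_single:
  assumes "j > 0"
  shows "hall (J (int j) (Poly_Mapping.single \<mu> c)) (Poly_Mapping.single \<nu> d) =
         hall (Poly_Mapping.single \<mu> c) (J (- int j) (Poly_Mapping.single \<nu> d))"
proof (cases "Poly_Mapping.lookup \<mu> (j - 1) = 0")
  case True
  hence "\<mu> \<noteq> \<nu> + p_mon j" by (auto simp: lookup_add lookup_p_mon)
  with True show ?thesis
    using assms by (simp add: J_pos_single J_neg_single hall_single lookup_single when_def)
next
  case False
  define \<kappa> where "\<kappa> = \<mu> - p_mon j"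
  have \<mu>: "\<mu> = \<kappa> + p_mon j" unfolding \<kappa>_def by (rule p_mon_split) (use False in simp)
  have "(\<kappa> = \<nu>) = (\<kappa> + p_mon j = \<nu> + p_mon j)" by simp
  thus ?thesis
    using assms unfolding \<mu>
    by (auto simp: J_pos_single J_neg_single hall_single lookup_single when_def mz_add_p_mon lookup_add
        lookup_p_mon algebra_simps)
qed

lemma J_adjoint_pos: "j > 0 \<Longrightarrow> hall (J (int j) f) g = hall f (J (- int j) g)"
proof (induction f rule: fock_induct)
  case (single x c)
  show ?case using single
    by (induction g rule: fock_induct) (auto simp: J_add hall_add_right J_adjoint_single)
qed (auto simp: J_add hall_add_left)

lemma hall_commute: "hall f g = hall g f"
  by (induction f rule: fock_induct)
     (auto simp: hall_add_left hall_add_right hall_single hall_single_right)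

lemma J_adjoint: "j \<noteq> 0 \<Longrightarrow> hall (J j f) g = hall f (J (- j) g)"
  using J_adjoint_pos[of "nat j" f g] J_adjoint_pos[of "nat (- j)" g f]
  by (cases "j > 0") (auto simp: hall_commute)

lemma Jlist_adjoint: "0 \<notin> set js \<Longrightarrow> hall (Jlist js f) g = hall f (Jlist (rev (map uminus js)) g)"
  by (induction js arbitrary: g) (auto simp: J_adjoint Jlist_append)

section \<open>Change of degree and length under words in the operators J_j\<close>

lemma J_single_cases:
  assumes "j \<noteq> 0"
  obtains \<nu> d where "J j (Poly_Mapping.single \<mu> c) = Poly_Mapping.single \<nu> d"
    "d \<noteq> 0 \<Longrightarrow> int (mdeg \<nu>) = int (mdeg \<mu>) - j"
    "d \<noteq> 0 \<Longrightarrow> int (mlen \<nu>) = int (mlen \<mu>) - sgn j"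
proof (cases "j > 0")
  case True
  define n where "n = nat j"
  have n: "j = int n" "n > 0" using True by (auto simp: n_def)
  have "mdeg \<mu> = mdeg (\<mu> - p_mon n) + n \<and> mlen \<mu> = mlen (\<mu> - p_mon n) + 1"
    if "Poly_Mapping.lookup \<mu> (n - 1) \<noteq> 0"
    using p_mon_split[OF that] n mdeg_p_mon[of n] mlen_p_mon[of n] mdeg_add[of "\<mu> - p_mon n" "p_mon n"]
      mlen_add[of "\<mu> - p_mon n" "p_mon n"] by simp
  thus ?thesis using that[OF J_pos_single[of n \<mu> c, folded n(1)]] n by fastforce
next
  case False
  define n where "n = nat (- j)"
  have n: "j = - int n" "n > 0" using False assms by (auto simp: n_def)
  show ?thesis
    using that[OF J_neg_single[of n \<mu> c, folded n(1)]] n by (auto simp: mdeg_add mlen_add mdeg_p_mon)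
qed

text \<open>The image of a monomial is a multiple of a single monomial. The two balances are
  conditional on \<open>d\<close> being nonzero because truncated subtraction of exponents leaves a
  meaningless index once the monomial has been annihilated.\<close>

lemma Jlist_single_cases:
  assumes "0 \<notin> set js"
  obtains \<nu> d where "Jlist js (Poly_Mapping.single \<mu> c) = Poly_Mapping.single \<nu> d"
    "d \<noteq> 0 \<Longrightarrow> int (mdeg \<nu>) = int (mdeg \<mu>) - sum_list js"
    "d \<noteq> 0 \<Longrightarrow> int (mlen \<nu>) = int (mlen \<mu>) - sum_list (map sgn js)"
  using assms
proof (induction js arbitrary: thesis)
  case Nil
  show ?case by (rule Nil(1)[of \<mu> c]) auto
next
  case (Cons j js)
  obtain \<kappa> d where 1: "Jlist js (Poly_Mapping.single \<mu> c) = Poly_Mapping.single \<kappa> d"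
    "d \<noteq> 0 \<Longrightarrow> int (mdeg \<kappa>) = int (mdeg \<mu>) - sum_list js"
    "d \<noteq> 0 \<Longrightarrow> int (mlen \<kappa>) = int (mlen \<mu>) - sum_list (map sgn js)"
    using Cons by (metis list.set_intros(2))
  have "j \<noteq> 0" using Cons.prems by auto
  then obtain \<nu> e where 2: "J j (Poly_Mapping.single \<kappa> d) = Poly_Mapping.single \<nu> e"
    "e \<noteq> 0 \<Longrightarrow> int (mdeg \<nu>) = int (mdeg \<kappa>) - j"
    "e \<noteq> 0 \<Longrightarrow> int (mlen \<nu>) = int (mlen \<kappa>) - sgn j"
    using J_single_cases by metis
  have "e = 0" if "d = 0"
    using 2(1) that by (metis J_0 single_zero lookup_single_eq lookup_zero)
  thus ?case using 1 2 Cons.prems(1)[of \<nu> e] by auto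
qed

lemma Jlist_lookup_nonzero:
  assumes "0 \<notin> set js" "Poly_Mapping.lookup (Jlist js (Poly_Mapping.single \<mu> c)) \<nu> \<noteq> 0"
  shows "int (mdeg \<nu>) = int (mdeg \<mu>) - sum_list js"
    and "int (mlen \<nu>) = int (mlen \<mu>) - sum_list (map sgn js)"
proof -
  obtain \<kappa> d where 1: "Jlist js (Poly_Mapping.single \<mu> c) = Poly_Mapping.single \<kappa> d"
    "d \<noteq> 0 \<Longrightarrow> int (mdeg \<kappa>) = int (mdeg \<mu>) - sum_list js"
    "d \<noteq> 0 \<Longrightarrow> int (mlen \<kappa>) = int (mlen \<mu>) - sum_list (map sgn js)"
    using Jlist_single_cases[OF assms(1)] by metis
  have "\<nu> = \<kappa> \<and> d \<noteq> 0" using assms(2) 1(1) by (auto simp: lookup_single when_def split: if_splits)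
  thus "int (mdeg \<nu>) = int (mdeg \<mu>) - sum_list js"
    "int (mlen \<nu>) = int (mlen \<mu>) - sum_list (map sgn js)" using 1 by auto
qed

definition nneg :: "int list \<Rightarrow> nat" where "nneg js = length (filter (\<lambda>j. j < 0) js)"

lemma sum_list_pos_ge: "\<forall>x\<in>set xs. (x::int) > 0 \<Longrightarrow> int (length xs) \<le> sum_list xs \<and> (\<forall>x\<in>set xs. x \<le> sum_list xs)"
proof (induction xs)
  case (Cons a xs)
  have "sum_list xs \<ge> 0" by (rule sum_list_nonneg) (use Cons in auto)
  with Cons show ?case by auto
qed auto

lemma sum_list_neg_le: "\<forall>x\<in>set xs. (x::int) < 0 \<Longrightarrow> sum_list xs \<le> - int (length xs) \<and> (\<forall>x\<in>set xs. sum_list xs \<le> x)"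
proof (induction xs)
  case (Cons a xs)
  have "sum_list xs \<le> 0" by (rule sum_list_nonpos) (use Cons in auto)
  with Cons show ?case by auto
qed auto

lemma sum_list_signs:
  assumes "0 \<notin> set (js::int list)"
  shows "sum_list js = sum_list (filter (\<lambda>j. j < 0) js) + sum_list (filter (\<lambda>j. j > 0) js)"
    and "length js = length (filter (\<lambda>j. j < 0) js) + length (filter (\<lambda>j. j > 0) js)"
    and "set js = set (filter (\<lambda>j. j < 0) js) \<union> set (filter (\<lambda>j. j > 0) js)"
  using assms by (induction js) auto

text \<open>In normal order all annihilators act first, so together they remove at most the degree
  of \<mu>; by the degree balance the creators then add at most the degree of \<nu>. Every entry has
  absolute value at least 1, which bounds the number of entries as well as their size.\<close>

lemma normal_ordered_nonzero:
  assumes "0 \<notin> set js" "mat_of (normal_ordered js) \<nu> \<mu> \<noteq> 0"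
  shows "int (mdeg \<nu>) = int (mdeg \<mu>) - sum_list js"
    and "int (mlen \<nu>) + int (length js) = int (mlen \<mu>) + 2 * int (nneg js)"
    and "length js \<le> mdeg \<mu> + mdeg \<nu>"
    and "set js \<subseteq> {- int (mdeg \<mu> + mdeg \<nu>)..int (mdeg \<mu> + mdeg \<nu>)}"
proof -
  define N P where "N = filter (\<lambda>j. j < 0) js" and "P = filter (\<lambda>j. j > 0) js"
  have sg: "sum_list (map sgn N) = - int (length N)" "sum_list (map sgn P) = int (length P)"
    unfolding N_def P_def by (induction js) auto
  have nz: "Poly_Mapping.lookup (Jlist (N @ P) (Poly_Mapping.single \<mu> 1)) \<nu> \<noteq> 0" "0 \<notin> set (N @ P)"
    using assms by (auto simp: mat_of_def normal_ordered_eq N_def P_def)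
  note * = Jlist_lookup_nonzero[OF nz(2,1)]
  note s = sum_list_signs[OF assms(1), folded N_def P_def]
  show d: "int (mdeg \<nu>) = int (mdeg \<mu>) - sum_list js" using * s by simp
  show "int (mlen \<nu>) + int (length js) = int (mlen \<mu>) + 2 * int (nneg js)"
    using * s sg by (simp add: nneg_def N_def[symmetric])
  \<comment> \<open>\<kappa> is the monomial reached after all annihilators and before any
    creator.\<close>
  obtain \<kappa> e where 1: "Jlist P (Poly_Mapping.single \<mu> 1) = Poly_Mapping.single \<kappa> e"
    "e \<noteq> 0 \<Longrightarrow> int (mdeg \<kappa>) = int (mdeg \<mu>) - sum_list P"
    using Jlist_single_cases[of P \<mu> 1] nz(2) by (metis Un_iff set_append)
  have "e \<noteq> 0" using nz(1) 1(1) by (auto simp: Jlist_append)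
  hence P: "sum_list P \<le> int (mdeg \<mu>)" using 1(2) by simp
  moreover have "\<forall>x\<in>set N. x < 0" "\<forall>x\<in>set P. x > 0" by (auto simp: N_def P_def)
  note q = sum_list_neg_le[OF this(1)] sum_list_pos_ge[OF this(2)]
  have N: "- sum_list N \<le> int (mdeg \<nu>)" using d P s(1) by linarith
  show "length js \<le> mdeg \<mu> + mdeg \<nu>" using s(2) q P N by linarith
  show "set js \<subseteq> {- int (mdeg \<mu> + mdeg \<nu>)..int (mdeg \<mu> + mdeg \<nu>)}"
  proof
    fix x assume "x \<in> set js"
    with s(3) consider "x \<in> set N" | "x \<in> set P" by auto
    thus "x \<in> {- int (mdeg \<mu> + mdeg \<nu>)..int (mdeg \<mu> + mdeg \<nu>)}"
    proof cases
      case 1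
      hence "sum_list N \<le> x" "x < 0" using q by (auto simp: N_def)
      thus ?thesis using N by auto
    next
      case 2
      hence "x \<le> sum_list P" "x > 0" using q by (auto simp: P_def)
      thus ?thesis using P by auto
    qed
  qed
qed

section \<open>Substituting the generating series of the variables\<close>

definition lift_fock :: "complex fps \<Rightarrow> fock fps" where
  "lift_fock f = Abs_fps (\<lambda>i. Poly_Mapping.single 0 (fps_nth f i))"

definition Pser :: "fock fps" where
  "Pser = Abs_fps (\<lambda>m. if m = 0 then 0 else Poly_Mapping.single (p_mon m) 1)"

text \<open>\<open>Ksub f\<close> is f(z, P(z)). The sum over powers of s may stop at
  \<open>b = n\<close> because P has no constant term.\<close>

definition Ksub :: "series_zs \<Rightarrow> fock fps" where
  "Ksub f = Abs_fps (\<lambda>n. \<Sum>b\<le>n. fps_nth (lift_fock (fps_nth f b) * Pser ^ b) n)"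

lemma lift_fock_nth [simp]: "fps_nth (lift_fock f) i = Poly_Mapping.single 0 (fps_nth f i)"
  by (simp add: lift_fock_def)

lemma single_sum: "Poly_Mapping.single k (\<Sum>x\<in>A. f x) = (\<Sum>x\<in>A. Poly_Mapping.single k (f x))"
  by (induction A rule: infinite_finite_induct) (auto simp: single_add)

lemma lift_fock_mult: "lift_fock (f * g) = lift_fock f * lift_fock g"
  by (rule fps_ext) (simp add: fps_mult_nth single_sum mult_single)

lemma lift_fock_add: "lift_fock (f + g) = lift_fock f + lift_fock g"
  by (rule fps_ext) (simp add: single_add)

lemma lift_fock_diff: "lift_fock (f - g) = lift_fock f - lift_fock g"
  by (rule fps_ext) (simp add: single_diff)

lemma lift_fock_0 [simp]: "lift_fock 0 = 0"
  by (rule fps_ext) simp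

lemma lift_fock_sum: "lift_fock (sum f A) = (\<Sum>x\<in>A. lift_fock (f x))"
  by (induction A rule: infinite_finite_induct) (auto simp: lift_fock_add)

lemma lift_fock_of_nat: "lift_fock (of_nat b * f) = of_nat b * lift_fock f"
proof (rule fps_ext)
  fix n
  have "Poly_Mapping.single 0 (of_nat b * c) = of_nat b * (Poly_Mapping.single 0 c :: fock)" for c
    by (simp add: mult_single flip: single_of_nat)
  thus "fps_nth (lift_fock (of_nat b * f)) n = fps_nth (of_nat b * lift_fock f) n"
    by (simp add: fps_mult_of_nat_nth)
qed

lemma Pser_nth: "fps_nth Pser m = (if m = 0 then 0 else Poly_Mapping.single (p_mon m) 1)"
  by (simp add: Pser_def)

lemma Pser_power_nth_less: "n < b \<Longrightarrow> fps_nth (Pser ^ b) n = 0"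
  by (metis startsby_zero_power_prefix Pser_nth)

lemma fps_mult_nth_agree:
  assumes "\<And>i. i \<le> n \<Longrightarrow> fps_nth F i = fps_nth G i" "\<And>i. i \<le> n \<Longrightarrow> fps_nth F' i = fps_nth G' i"
  shows "fps_nth (F * F') n = fps_nth (G * G') n"
  using assms by (auto simp: fps_mult_nth intro!: sum.cong)

lemma mult_Pser_power_nth_less: "n < b \<Longrightarrow> fps_nth (F * Pser ^ b) n = 0"
  by (auto simp: fps_mult_nth Pser_power_nth_less intro!: sum.neutral)

text \<open>Agrees with \<open>Ksub f\<close> through order \<open>N\<close> in z, but is a finite
  sum, so that a derivation can be applied to it term by term.\<close>

definition Ktrunc :: "nat \<Rightarrow> series_zs \<Rightarrow> fock fps" where
  "Ktrunc N f = (\<Sum>b\<le>N. lift_fock (fps_nth f b) * Pser ^ b)"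

lemma Ksub_nth: "n \<le> N \<Longrightarrow> fps_nth (Ksub f) n = fps_nth (Ktrunc N f) n"
  unfolding Ksub_def Ktrunc_def fps_nth_Abs_fps fps_sum_nth
  by (rule sum.mono_neutral_left) (auto simp: mult_Pser_power_nth_less)

lemma Ksub_diff: "Ksub (f - g) = Ksub f - Ksub g"
  by (rule fps_ext) (simp add: Ksub_def lift_fock_diff algebra_simps sum_subtractf)

lemma Ksub_mult: "Ksub (f * g) = Ksub f * Ksub g"
proof (rule fps_ext)
  fix n
  define t where "t = (\<lambda>i j. fps_nth (lift_fock (fps_nth f i) * lift_fock (fps_nth g j) * Pser ^ (i + j)) n)"
  \<comment> \<open>The power of P with exponent \<open>i + j\<close> starts at order
    \<open>i + j\<close>, so the square of summation can be cut down to a triangle.\<close>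
  have t: "i + j \<le> n" if "t i j \<noteq> 0" for i j
    using that mult_Pser_power_nth_less[of n "i + j"] by (auto simp: t_def simp flip: not_less)
  have "fps_nth (Ksub f * Ksub g) n = fps_nth (Ktrunc n f * Ktrunc n g) n"
    by (rule fps_mult_nth_agree) (auto simp: Ksub_nth)
  also have "Ktrunc n f * Ktrunc n g = (\<Sum>i\<le>n. \<Sum>j\<le>n.
      lift_fock (fps_nth f i) * lift_fock (fps_nth g j) * Pser ^ (i + j))"
    by (simp add: Ktrunc_def sum_product power_add algebra_simps)
  also have "fps_nth \<dots> n = (\<Sum>i\<le>n. \<Sum>j\<le>n. t i j)"
    by (simp add: fps_sum_nth t_def)
  also have "\<dots> = (\<Sum>i\<le>n. \<Sum>j\<le>n - i. t i j)"
    by (intro sum.cong[OF refl] sum.mono_neutral_right) (auto dest!: t)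
  also have "\<dots> = (\<Sum>b\<le>n. \<Sum>i\<le>b. t i (b - i))"
  proof -
    have "(\<Sum>i\<le>n. \<Sum>j\<le>n - i. t i j) = (\<Sum>(i, j)\<in>{(i, j). i + j \<le> n}. t i j)"
      by (subst sum.Sigma) (auto intro!: sum.cong)
    thus ?thesis by (simp only: sum.triangle_reindex_eq)
  qed
  also have "\<dots> = fps_nth (Ksub (f * g)) n"
    by (simp add: Ksub_def t_def fps_mult_nth[of f g] lift_fock_sum lift_fock_mult sum_distrib_right
        fps_sum_nth atMost_atLeast0)
  finally show "fps_nth (Ksub (f * g)) n = fps_nth (Ksub f * Ksub g) n" by simp
qed

section \<open>Derivations\<close>

definition derivation :: "('a::comm_ring_1 \<Rightarrow> 'a) \<Rightarrow> bool" where
  "derivation \<delta> \<longleftrightarrow> (\<forall>x y. \<delta> (x + y) = \<delta> x + \<delta> y) \<and> (\<forall>x y. \<delta> (x * y) = \<delta> x * y + x * \<delta> y)"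

lemma derivation_add: "derivation \<delta> \<Longrightarrow> \<delta> (x + y) = \<delta> x + \<delta> y"
  and derivation_mult: "derivation \<delta> \<Longrightarrow> \<delta> (x * y) = \<delta> x * y + x * \<delta> y"
  by (simp_all add: derivation_def)

lemma derivation_0: "derivation \<delta> \<Longrightarrow> \<delta> 0 = 0"
  using derivation_add[of \<delta> 0 0] by simp

lemma derivation_diff: "derivation \<delta> \<Longrightarrow> \<delta> (x - y) = \<delta> x - \<delta> y"
  using derivation_add[of \<delta> "x - y" y] by simp

lemma derivation_1: "derivation \<delta> \<Longrightarrow> \<delta> 1 = 0"
  using derivation_mult[of \<delta> 1 1] by simp

lemma derivation_sum: "derivation \<delta> \<Longrightarrow> \<delta> (sum f A) = (\<Sum>x\<in>A. \<delta> (f x))"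
  by (induction A rule: infinite_finite_induct) (auto simp: derivation_add derivation_0)

lemma derivation_power: "derivation \<delta> \<Longrightarrow> \<delta> (x ^ n) = of_nat n * x ^ (n - 1) * \<delta> x"
proof (induction n)
  case (Suc n)
  thus ?case by (cases n) (auto simp: derivation_mult derivation_1 algebra_simps)
qed (auto simp: derivation_1)

text \<open>Chain rule for s = P(z), where \<epsilon> is the action on coefficients. The condition
  \<open>filt\<close> is continuity in the z-adic sense: it reduces the claim to a finite
  truncation, where the Leibniz rule suffices.\<close>

lemma derivation_Ksub:
  assumes \<delta>: "derivation \<delta>" and lift: "\<And>g. \<delta> (lift_fock g) = lift_fock (\<epsilon> g)"
    and filt: "\<And>F n. (\<And>i. i \<le> n \<Longrightarrow> fps_nth F i = 0) \<Longrightarrow> fps_nth (\<delta> F) n = 0"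
  shows "\<delta> (Ksub f) = Ksub (Abs_fps (\<lambda>b. \<epsilon> (fps_nth f b))) + Ksub (fps_deriv f) * \<delta> Pser"
proof (rule fps_ext)
  fix n
  let ?g = "Abs_fps (\<lambda>b. \<epsilon> (fps_nth f b))"
  \<comment> \<open>The truncation is at \<open>Suc n\<close> because differentiation in s shifts
    the index by one and leaves a truncation at \<open>n\<close>.\<close>
  have "fps_nth (\<delta> (Ksub f - Ktrunc (Suc n) f)) n = 0"
    by (rule filt) (simp add: Ksub_nth[of _ "Suc n"])
  hence "fps_nth (\<delta> (Ksub f)) n = fps_nth (\<delta> (Ktrunc (Suc n) f)) n"
    by (simp add: derivation_diff[OF \<delta>])
  also have "\<delta> (Ktrunc (Suc n) f) = Ktrunc (Suc n) ?g +
      (\<Sum>b\<le>Suc n. lift_fock (of_nat b * fps_nth f b) * Pser ^ (b - 1) * \<delta> Pser)"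
    by (simp add: Ktrunc_def derivation_sum[OF \<delta>] derivation_mult[OF \<delta>] derivation_power[OF \<delta>] lift
        lift_fock_of_nat sum.distrib algebra_simps del: sum.atMost_Suc)
  also have "(\<Sum>b\<le>Suc n. lift_fock (of_nat b * fps_nth f b) * Pser ^ (b - 1) * \<delta> Pser) =
      Ktrunc n (fps_deriv f) * \<delta> Pser"
    by (subst sum.atMost_Suc_shift) (simp add: Ktrunc_def sum_distrib_right)
  finally have "fps_nth (\<delta> (Ksub f)) n =
      fps_nth (Ktrunc (Suc n) ?g) n + fps_nth (Ktrunc n (fps_deriv f) * \<delta> Pser) n"
    by simp
  also have "fps_nth (Ktrunc n (fps_deriv f) * \<delta> Pser) n = fps_nth (Ksub (fps_deriv f) * \<delta> Pser) n"
    by (rule fps_mult_nth_agree) (auto simp: Ksub_nth)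
  finally show "fps_nth (\<delta> (Ksub f)) n = fps_nth (Ksub ?g + Ksub (fps_deriv f) * \<delta> Pser) n"
    by (simp add: Ksub_nth[of n "Suc n"])
qed

section \<open>The derivation D of the Fock space\<close>

definition Csym :: "series_zs \<Rightarrow> nat \<Rightarrow> fock" where
  "Csym h j = fps_nth (Ksub h) j"

text \<open>Restricting to the variables that occur in \<open>f\<close> makes the sum over all j in
  D finite: for every other j >= 1 the operator J_j kills \<open>f\<close>.\<close>

definition fvars :: "fock \<Rightarrow> nat set" where
  "fvars f = (\<Union>\<mu>\<in>Poly_Mapping.keys f. Suc ` Poly_Mapping.keys \<mu>)"

definition Dop :: "series_zs \<Rightarrow> fock \<Rightarrow> fock" where
  "Dop h f = (\<Sum>j\<in>fvars f. Csym h j * J (int j) f)"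

lemma finite_fvars [simp]: "finite (fvars f)"
  by (simp add: fvars_def)

lemma J_not_fvars: "j \<ge> 1 \<Longrightarrow> j \<notin> fvars f \<Longrightarrow> J (int j) f = 0"
proof -
  assume j: "j \<ge> 1" "j \<notin> fvars f"
  have "Poly_Mapping.lookup \<mu> (j - 1) = 0" if "\<mu> \<in> Poly_Mapping.keys f" for \<mu>
  proof (rule ccontr)
    assume "Poly_Mapping.lookup \<mu> (j - 1) \<noteq> 0"
    hence "Suc (j - 1) \<in> Suc ` Poly_Mapping.keys \<mu>" by (auto simp: in_keys_iff)
    with j that show False by (auto simp: fvars_def)
  qed
  hence "p_deriv j f = 0" unfolding p_deriv_def by (intro sum.neutral) auto
  thus ?thesis using j(1) by (simp add: J_def)
qed

text \<open>Index 0 has to be excluded, since \<open>J 0\<close> falls into the branch of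
  multiplication by a variable and does not kill \<open>f\<close>.\<close>

lemma Dop_superset:
  assumes "finite A" "fvars f \<subseteq> A" "0 \<notin> A"
  shows "Dop h f = (\<Sum>j\<in>A. Csym h j * J (int j) f)"
  unfolding Dop_def using assms J_not_fvars
  by (intro sum.mono_neutral_left) (auto, metis J_not_fvars One_nat_def Suc_leI gr0I mult_zero_right)

lemma zero_notin_fvars [simp]: "0 \<notin> fvars f"
  by (auto simp: fvars_def)

lemma derivation_Dop: "derivation (Dop h)"
  unfolding derivation_def
proof (intro conjI allI)
  fix f g :: fock
  let ?A = "fvars f \<union> fvars g \<union> fvars (f + g) \<union> fvars (f * g)"
  note s = Dop_superset[of ?A]
  show "Dop h (f + g) = Dop h f + Dop h g"
    by (subst (1 2 3) s) (auto simp: J_add algebra_simps sum.distrib)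
  have "J (int j) (f * g) = J (int j) f * g + f * J (int j) g" if "j \<in> ?A" for j
    using that by (intro J_pos_mult) (auto intro!: gr0I)
  hence "(\<Sum>j\<in>?A. Csym h j * J (int j) (f * g)) =
      (\<Sum>j\<in>?A. Csym h j * (J (int j) f * g + f * J (int j) g))"
    by (intro sum.cong refl arg_cong2[where f = "(*)"])
  thus "Dop h (f * g) = Dop h f * g + f * Dop h g"
    by (subst (1 2 3) s) (auto simp: algebra_simps sum.distrib sum_distrib_left)
qed

lemma Dop_const: "Dop h (Poly_Mapping.single 0 c) = 0"
  by (cases "c = 0") (simp_all add: Dop_def fvars_def)

lemma Dop_p_mon: "m \<ge> 1 \<Longrightarrow> Dop h (Poly_Mapping.single (p_mon m) 1) = of_nat m * Csym h m"
  by (simp add: Dop_def fvars_def J_pos_single lookup_p_mon algebra_simps)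

section \<open>Matrix elements of the cut-and-join operator\<close>

text \<open>The value \<open>c\<close> may be 0: the predicate bounds the order from below and
  records the coefficient at the bound. In this form it passes through sums and products without a
  case distinction on cancellation.\<close>

definition fls_lead :: "int \<Rightarrow> 'a::comm_ring_1 \<Rightarrow> 'a fls \<Rightarrow> bool" where
  "fls_lead n c f \<longleftrightarrow> (\<forall>i<n. fls_nth f i = 0) \<and> fls_nth f n = c"

lemma fls_lead_mult:
  assumes f: "fls_lead n c f" and g: "fls_lead m d g"
  shows "fls_lead (n + m) (c * d) (f * g)"
proof -
  let ?I = "\<lambda>k. {fls_subdegree f..k - fls_subdegree g}"
  have f0: "fls_nth f i = 0" if "i < n" for i using f that by (auto simp: fls_lead_def)
  have g0: "fls_nth g i = 0" if "i < m" for i using g that by (auto simp: fls_lead_def)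
  have "fls_nth f i * fls_nth g (k - i) = 0" if "k < n + m" for i k
    using f0[of i] g0[of "k - i"] that by (cases "i < n") auto
  hence 1: "fls_nth (f * g) k = 0" if "k < n + m" for k
    using that by (simp add: fls_times_nth(2) sum.neutral)
  have "fls_nth f i * fls_nth g (n + m - i) = 0" if "i \<noteq> n" for i
    using f0[of i] g0[of "n + m - i"] that by (cases "i < n") auto
  hence "fls_nth (f * g) (n + m) = (\<Sum>i\<in>?I (n + m). if i = n then fls_nth f n * fls_nth g m else 0)"
    unfolding fls_times_nth(2) by (intro sum.cong) auto
  also have "\<dots> = fls_nth f n * fls_nth g m"
    by auto
  finally show ?thesis using 1 f g by (auto simp: fls_lead_def)
qed

lemma fls_lead_prod_list:
  "(\<And>x. x \<in> set xs \<Longrightarrow> fls_lead (n x) (c x) (f x)) \<Longrightarrow>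
     fls_lead (\<Sum>x\<leftarrow>xs. n x) (\<Prod>x\<leftarrow>xs. c x) (\<Prod>x\<leftarrow>xs. f x)"
  by (induction xs) (auto simp: fls_lead_mult fls_lead_def[of 0 1 1])

lemma fls_lead_varsig: "j \<noteq> 0 \<Longrightarrow> fls_lead 1 1 (varsig j * fls_const (1 / of_int j))"
proof -
  assume j: "j \<noteq> 0"
  have "fls_nth (varsig j) i = 0" if "i < 1" for i
    using that by (cases "i = 0") (auto simp: varsig_def)
  moreover have "fls_nth (varsig j) 1 = of_int j"
    by (simp add: varsig_def)
  ultimately have "fls_lead 1 (of_int j) (varsig j)" by (simp add: fls_lead_def)
  from fls_lead_mult[OF this, of 0 "1 / of_int j" "fls_const (1 / of_int j)"] j show ?thesis
    by (simp add: fls_lead_def)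
qed

lemma fls_lead_inverse_varsig: "fls_lead (-1) 1 (inverse (varsig 1))"
proof -
  have l: "fls_lead 1 1 (varsig 1)" using fls_lead_varsig[of 1] by simp
  hence "fls_subdegree (varsig 1) = 1" by (intro fls_subdegree_eqI) (auto simp: fls_lead_def)
  thus ?thesis using l fls_inverse_base2[of "varsig 1"] by (auto simp: fls_lead_def)
qed

section \<open>Expansion of the operators F over finitely many words\<close>

definition bos_coeff :: "int list \<Rightarrow> complex fls" where
  "bos_coeff js = inverse (varsig 1) * (\<Prod>j\<leftarrow>js. varsig j * fls_const (1 / of_int j))"

text \<open>Each factor varsigma(ju)/j is u plus higher terms and 1/varsigma(u) starts with 1/u, so
  the lowest coefficient does not depend on the entries of the word.\<close>

lemma fls_lead_bos_coeff: "0 \<notin> set js \<Longrightarrow> fls_lead (int (length js) - 1) 1 (bos_coeff js)"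
proof -
  assume "0 \<notin> set js"
  have p: "(\<Prod>j\<leftarrow>js. 1) = (1::complex)" by (induction js) auto
  from \<open>0 \<notin> set js\<close> have "fls_lead (\<Sum>j\<leftarrow>js. 1) (\<Prod>j\<leftarrow>js. 1) (\<Prod>j\<leftarrow>js. varsig j * fls_const (1 / of_int j))"
    by (intro fls_lead_prod_list fls_lead_varsig) auto
  hence "fls_lead (int (length js)) 1 (\<Prod>j\<leftarrow>js. varsig j * fls_const (1 / of_int j))"
    using p by (simp add: sum_list_triv)
  from fls_lead_mult[OF fls_lead_inverse_varsig this] show ?thesis by (simp add: bos_coeff_def)
qed

text \<open>Contains every word without zeros and of sum -k whose matrix entry is nonzero; the two
  bounds are those of \<open>normal_ordered_nonzero\<close> and make the set finite.\<close>

definition jlists :: "nat \<Rightarrow> mon \<Rightarrow> mon \<Rightarrow> int list set" where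
  "jlists k \<nu> \<mu> = {js. 0 \<notin> set js \<and> sum_list js = - int k \<and> length js \<le> mdeg \<mu> + mdeg \<nu> \<and>
      set js \<subseteq> {- int (mdeg \<mu> + mdeg \<nu>)..int (mdeg \<mu> + mdeg \<nu>)}}"

lemma finite_jlists [simp]: "finite (jlists k \<nu> \<mu>)"
  by (rule finite_subset[OF _ finite_lists_length_le[of "{- int (mdeg \<mu> + mdeg \<nu>)..int (mdeg \<mu> + mdeg \<nu>)}"
      "mdeg \<mu> + mdeg \<nu>"]]) (auto simp: jlists_def)

lemma Fop_eq:
  "Fop r k \<nu> \<mu> = (\<Sum>js\<in>jlists k \<nu> \<mu>.
     fact r / fact (length js) * fls_nth (bos_coeff js) (int r) * mat_of (normal_ordered js) \<nu> \<mu>)"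
proof -
  define g where "g js = (if 0 \<notin> set js \<and> sum_list js = - int k
       then fls_const (1 / fact (length js))
            * (\<Prod>j\<leftarrow>js. varsig j * fls_const (1 / of_int j))
            * fls_const (mat_of (normal_ordered js) \<nu> \<mu>)
       else 0)" for js
  have *: "js \<in> jlists k \<nu> \<mu>" if "g js \<noteq> 0" for js
  proof -
    have *: "0 \<notin> set js" "sum_list js = - int k" "mat_of (normal_ordered js) \<nu> \<mu> \<noteq> 0"
      using that by (auto simp: g_def split: if_splits)
    show ?thesis using normal_ordered_nonzero(3,4)[OF *(1,3)] * by (auto simp: jlists_def)
  qed
  from * have "Sum_any g = sum g (jlists k \<nu> \<mu>)"
    by (intro Sum_any.expand_superset) auto
  also have "\<dots> = (\<Sum>js\<in>jlists k \<nu> \<mu>. fls_const (1 / fact (length js))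
            * (\<Prod>j\<leftarrow>js. varsig j * fls_const (1 / of_int j))
            * fls_const (mat_of (normal_ordered js) \<nu> \<mu>))"
    by (intro sum.cong refl) (simp add: g_def jlists_def)
  finally have "bosE (- int k) \<nu> \<mu> = (\<Sum>js\<in>jlists k \<nu> \<mu>.
      fls_const (1 / fact (length js)) * bos_coeff js * fls_const (mat_of (normal_ordered js) \<nu> \<mu>))"
    unfolding bosE_def g_def[symmetric] bos_coeff_def
    by (simp only: sum_distrib_left mult_ac)
  thus ?thesis unfolding Fop_def by (simp add: fls_nth_sum sum_distrib_left mult.assoc)
qed

text \<open>The empty list is left out: its contribution is the vacuum expectation subtracted in \<open>cut_join\<close>.\<close>

definition Wcoeff :: "nat \<Rightarrow> nat \<Rightarrow> complex fmat" where
  "Wcoeff k r \<nu> \<mu> = (\<Sum>js\<in>jlists k \<nu> \<mu> - {[]}.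
     fact r / fact (length js) * fls_nth (bos_coeff js) (int r) * mat_of (normal_ordered js) \<nu> \<mu>)"

lemma mat_of_Nil: "mat_of (normal_ordered []) \<nu> \<mu> = fmat_one \<nu> \<mu>"
  by (simp add: mat_of_def normal_ordered_eq fmat_one_def lookup_single when_def)

lemma Fop_vac: "Fop r k 0 0 = (if k = 0 then fact r * fls_nth (bos_coeff []) (int r) else 0)"
proof -
  have "jlists k 0 0 = (if k = 0 then {[]} else {})" by (auto simp: jlists_def)
  thus ?thesis by (auto simp: Fop_eq mat_of_Nil fmat_one_def)
qed

lemma Wcoeff_eq: "Fop r k \<nu> \<mu> - Fop r k 0 0 * fmat_one \<nu> \<mu> = Wcoeff k r \<nu> \<mu>"
proof -
  have "[] \<in> jlists k \<nu> \<mu> \<longleftrightarrow> k = 0" by (auto simp: jlists_def)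
  thus ?thesis
    by (cases "k = 0") (simp_all add: Fop_eq[of r _ \<nu> \<mu>] Fop_vac Wcoeff_def sum.remove[of _ "[]"] mat_of_Nil)
qed

text \<open>A nonempty word of positive entries has positive sum. Hence, once the empty word is
  removed, every word in \<open>jlists\<close> creates at least one variable.\<close>

lemma nneg_ge_1:
  assumes "js \<noteq> []" "0 \<notin> set js" "sum_list js \<le> 0"
  shows "nneg js \<ge> 1"
proof (rule ccontr)
  assume "\<not> ?thesis"
  hence "\<forall>j\<in>set js. \<not> j < 0" by (auto simp: nneg_def Suc_le_eq filter_empty_conv)
  hence "\<forall>j\<in>set js. j > 0" using assms(2) by (metis linorder_neqE_linordered_idom)
  from sum_list_pos_ge[OF this] assms show False by (cases js) auto
qed

lemma Wcoeff_nonzero: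
  assumes "Wcoeff k r \<nu> \<mu> \<noteq> 0"
  obtains js where "js \<in> jlists k \<nu> \<mu>" "nneg js \<ge> 1" "length js \<le> r + 1"
    "int (mdeg \<nu>) = int (mdeg \<mu>) + int k"
    "int (mlen \<nu>) + int (length js) = int (mlen \<mu>) + 2 * int (nneg js)"
    "mat_of (normal_ordered js) \<nu> \<mu> \<noteq> 0"
proof -
  obtain js where js0: "js \<in> jlists k \<nu> \<mu> - {[]}" and js3:
    "fact r / fact (length js) * fls_nth (bos_coeff js) (int r) * mat_of (normal_ordered js) \<nu> \<mu> \<noteq> 0"
    using assms unfolding Wcoeff_def by (rule sum.not_neutral_contains_not_neutral)
  hence js: "js \<in> jlists k \<nu> \<mu>" "js \<noteq> []" by auto
  with js3 have js': "0 \<notin> set js" "sum_list js = - int k" "mat_of (normal_ordered js) \<nu> \<mu> \<noteq> 0"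
     "fls_nth (bos_coeff js) (int r) \<noteq> 0" by (auto simp: jlists_def)
  have "length js \<le> r + 1"
    using fls_lead_bos_coeff[OF js'(1)] js'(4) by (force simp: fls_lead_def)
  moreover have "nneg js \<ge> 1" by (rule nneg_ge_1) (use js js' in auto)
  ultimately show ?thesis
    using that[OF js(1)] normal_ordered_nonzero(1,2)[OF js'(1,3)] js' by simp
qed

section \<open>Weight estimate for the cut-and-join operator\<close>

lemma symbol_order:
  assumes "cut_join_symbol w" "fls_nth (w k r) n \<noteq> 0"
  shows "n \<ge> int r - 1"
proof -
  have "fls_nth (fps_nth (scaled_symbol w k) r) (n - int r) \<noteq> 0"
    using assms(2) by (simp add: scaled_symbol_def)
  with assms(1) obtain i where "n - int r = 2 * int i - 1" unfolding cut_join_symbol_def by blast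
  thus ?thesis by simp
qed

lemma leading_symbol_nth: "fps_nth (fps_nth (leading_symbol w) r) k = fls_nth (w k r) (int r - 1)"
  by (simp add: leading_symbol_def scaled_symbol_def)

text \<open>A word of length N with c creators changes the number of variables by 2c - N. With N
  \<le> r + 1, c \<ge> 1 and r - 1 \<le> n the loss of length is N - 2c \<le> r - 1 \<le> n, and
  equality throughout forces r = n + 1.\<close>

lemma symbol_Wcoeff_nonzero:
  assumes w: "cut_join_symbol w" and nz: "fls_nth (w k r) n * Wcoeff k r \<nu> \<mu> \<noteq> 0"
  shows "n \<ge> int r - 1" "int (mdeg \<nu>) = int (mdeg \<mu>) + int k"
    "n \<ge> int (mlen \<mu>) - int (mlen \<nu>)"
    "n = int (mlen \<mu>) - int (mlen \<nu>) \<Longrightarrow> int r = n + 1"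
proof -
  have "fls_nth (w k r) n \<noteq> 0" "Wcoeff k r \<nu> \<mu> \<noteq> 0" using nz by auto
  from Wcoeff_nonzero[OF this(2)] obtain js where js: "nneg js \<ge> 1" "length js \<le> r + 1"
    "int (mdeg \<nu>) = int (mdeg \<mu>) + int k"
    "int (mlen \<nu>) + int (length js) = int (mlen \<mu>) + 2 * int (nneg js)" by metis
  show n: "n \<ge> int r - 1" using symbol_order[OF w] \<open>fls_nth (w k r) n \<noteq> 0\<close> .
  show "int (mdeg \<nu>) = int (mdeg \<mu>) + int k" by fact
  show "n \<ge> int (mlen \<mu>) - int (mlen \<nu>)" using n js by linarith
  show "int r = n + 1" if "n = int (mlen \<mu>) - int (mlen \<nu>)" using n js that by linarith
qed

lemma cut_join_nth:
  assumes w: "cut_join_symbol w"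
  shows "fls_nth (cut_join w \<nu> \<mu>) n = Sum_any (\<lambda>(k, r). fls_nth (w k r) n * Wcoeff k r \<nu> \<mu>)"
  unfolding cut_join_def Wcoeff_eq
\<comment> \<open>The coefficients vanish below order -1, so the function under
  \<open>Abs_fls\<close> really is a Laurent series.\<close>
proof (rule nth_Abs_fls_lower_bound[of "-1"], intro allI impI)
  fix m :: int assume "m < -1"
  have "(\<lambda>(k, r). fls_nth (w k r) m * Wcoeff k r \<nu> \<mu>) = (\<lambda>_. 0)"
  proof (intro ext, clarify, rule ccontr)
    fix k r assume "fls_nth (w k r) m * Wcoeff k r \<nu> \<mu> \<noteq> 0"
    from symbol_Wcoeff_nonzero(1)[OF w this] \<open>m < -1\<close> show False by simp
  qed
  thus "Sum_any (\<lambda>(k, r). fls_nth (w k r) m * Wcoeff k r \<nu> \<mu>) = 0" by simp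
qed

lemma cut_join_below:
  assumes w: "cut_join_symbol w" and n: "n < int (mlen \<mu>) - int (mlen \<nu>) \<or> mdeg \<nu> < mdeg \<mu>"
  shows "fls_nth (cut_join w \<nu> \<mu>) n = 0"
proof -
  have "(\<lambda>(k, r). fls_nth (w k r) n * Wcoeff k r \<nu> \<mu>) = (\<lambda>_. 0)"
  proof (intro ext, clarify, rule ccontr)
    fix k r assume "fls_nth (w k r) n * Wcoeff k r \<nu> \<mu> \<noteq> 0"
    from symbol_Wcoeff_nonzero(2,3)[OF w this] n show False by linarith
  qed
  thus ?thesis unfolding cut_join_nth[OF w] by simp
qed

lemma cut_join_leading:
  assumes w: "cut_join_symbol w" and k: "mdeg \<nu> = mdeg \<mu> + k" and r: "mlen \<mu> + 1 = mlen \<nu> + r"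
  shows "fls_nth (cut_join w \<nu> \<mu>) (int (mlen \<mu>) - int (mlen \<nu>)) =
    fps_nth (fps_nth (leading_symbol w) r) k * Wcoeff k r \<nu> \<mu>"
proof -
  let ?n = "int (mlen \<mu>) - int (mlen \<nu>)"
  define g where "g = (\<lambda>(k, r). fls_nth (w k r) ?n * Wcoeff k r \<nu> \<mu>)"
  have "x = (k, r)" if "g x \<noteq> 0" for x
  proof -
    have "fls_nth (w (fst x) (snd x)) ?n * Wcoeff (fst x) (snd x) \<nu> \<mu> \<noteq> 0"
      using that by (simp add: g_def case_prod_beta)
    from symbol_Wcoeff_nonzero(2,4)[OF w this] have "fst x = k" "snd x = r" using k r by linarith+
    thus ?thesis by (simp add: prod_eq_iff)
  qed
  hence "Sum_any g = sum g {(k, r)}"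
    by (intro Sum_any.expand_superset) auto
  moreover have "?n = int r - 1" using r by linarith
  ultimately show ?thesis
    unfolding cut_join_nth[OF w] g_def[symmetric] leading_symbol_nth by (simp add: g_def)
qed

lemma cut_join_leading_0:
  assumes w: "cut_join_symbol w" and "\<not> (\<exists>k r. mdeg \<nu> = mdeg \<mu> + k \<and> mlen \<mu> + 1 = mlen \<nu> + r)"
  shows "fls_nth (cut_join w \<nu> \<mu>) (int (mlen \<mu>) - int (mlen \<nu>)) = 0"
proof -
  let ?n = "int (mlen \<mu>) - int (mlen \<nu>)"
  have "(\<lambda>(k, r). fls_nth (w k r) ?n * Wcoeff k r \<nu> \<mu>) = (\<lambda>_. 0)"
  proof (intro ext, clarify, rule ccontr)
    fix k r assume "fls_nth (w k r) ?n * Wcoeff k r \<nu> \<mu> \<noteq> 0"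
    from symbol_Wcoeff_nonzero(2,4)[OF w this] have "mdeg \<nu> = mdeg \<mu> + k" "mlen \<mu> + 1 = mlen \<nu> + r" by auto
    with assms(2) show False by blast
  qed
  thus ?thesis unfolding cut_join_nth[OF w] by simp
qed

section \<open>The leading part of the cut-and-join operator is adjoint to a derivation\<close>

text \<open>Compositions of n into r positive parts; they index the terms of the coefficient of z^n
  in P(z)^r.\<close>

definition plists :: "nat \<Rightarrow> nat \<Rightarrow> nat list set" where
  "plists n r = {ls. length ls = r \<and> sum_list ls = n \<and> 0 \<notin> set ls}"

lemma finite_plists [simp]: "finite (plists n r)"
  by (rule finite_subset[OF _ natpermute_finite[of n r]]) (auto simp: plists_def natpermute_def)

lemma plists_0: "plists n 0 = (if n = 0 then {[]} else {})"
  by (auto simp: plists_def)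

lemma plists_Suc: "plists n (Suc r) = (\<Union>i\<in>{1..n}. (#) i ` plists (n - i) r)"
  by (auto simp: plists_def length_Suc_conv image_iff)

lemma Pser_power_nth:
  "fps_nth (Pser ^ r) n = (\<Sum>ls\<in>plists n r. Poly_Mapping.single (sum_list (map p_mon ls)) 1)"
proof (induction r arbitrary: n)
  case (Suc r)
  have "fps_nth (Pser ^ Suc r) n = (\<Sum>i\<in>{0..n}. fps_nth Pser i * fps_nth (Pser ^ r) (n - i))"
    by (simp add: fps_mult_nth)
  also have "\<dots> = (\<Sum>i\<in>{1..n}. fps_nth Pser i * fps_nth (Pser ^ r) (n - i))"
    by (rule sum.mono_neutral_right) (auto simp: Pser_nth)
  also have "\<dots> = (\<Sum>i\<in>{1..n}. \<Sum>ls\<in>(#) i ` plists (n - i) r.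
      Poly_Mapping.single (sum_list (map p_mon ls)) 1)"
    by (intro sum.cong refl) (simp add: Pser_nth Suc sum.reindex sum_distrib_left mult_single)
  also have "\<dots> = (\<Sum>ls\<in>plists n (Suc r). Poly_Mapping.single (sum_list (map p_mon ls)) 1)"
    unfolding plists_Suc by (intro sum.UNION_disjoint[symmetric]) auto
  finally show ?case .
qed (simp add: plists_0)

lemma single_mult_eq_Jlist:
  "Poly_Mapping.single (sum_list (map p_mon ls)) 1 * f = Jlist (map (\<lambda>l. - int l) ls) f"
proof (induction ls)
  case (Cons l ls)
  have "Poly_Mapping.single (sum_list (map p_mon (l # ls))) 1 * f =
      Poly_Mapping.single (p_mon l) 1 * (Poly_Mapping.single (sum_list (map p_mon ls)) 1 * f)"
    by (simp add: mult_single flip: mult.assoc)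
  thus ?case by (simp add: Cons J_def)
qed simp

lemma lookup_single_0_mult: "Poly_Mapping.lookup (Poly_Mapping.single 0 c * f) \<mu> = c * Poly_Mapping.lookup f \<mu>"
  for f :: fock
  by (induction f rule: fock_induct)
     (auto simp: mult_single lookup_single lookup_add algebra_simps when_def)

lemma Csym_eq:
  "Csym h j = (\<Sum>r\<le>j. \<Sum>k\<le>j. Poly_Mapping.single 0 (fps_nth (fps_nth h r) k) * fps_nth (Pser ^ r) (j - k))"
  by (simp add: Csym_def Ksub_def fps_mult_nth atMost_atLeast0)

lemma fvars_single: "fvars (Poly_Mapping.single \<nu> 1) \<subseteq> {1..mdeg \<nu>}"
proof
  fix j assume "j \<in> fvars (Poly_Mapping.single \<nu> 1)"
  then obtain i where i: "j = Suc i" "Poly_Mapping.lookup \<nu> i \<noteq> 0" by (auto simp: fvars_def in_keys_iff)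
  hence "Suc i * 1 \<le> Suc i * Poly_Mapping.lookup \<nu> i" by (intro mult_le_mono) auto
  with lookup_le_mdeg[of i \<nu>] i show "j \<in> {1..mdeg \<nu>}" by simp
qed

text \<open>Matrix entry of a word that annihilates the parts \<open>ls\<close> and then creates one
  variable p_j. The terms of weight 0 all have this shape.\<close>

definition Jcoeff :: "mon \<Rightarrow> mon \<Rightarrow> nat \<Rightarrow> nat list \<Rightarrow> complex" where
  "Jcoeff \<nu> \<mu> j ls = Poly_Mapping.lookup (Jlist (- int j # map int ls) (Poly_Mapping.single \<mu> 1)) \<nu>"

lemma sum_list_map_int: "sum_list (map int ls) = int (sum_list ls)"
  by (induction ls) auto

lemma Jcoeff_nonzero:
  assumes "Jcoeff \<nu> \<mu> j ls \<noteq> 0" "ls \<in> plists n r" "j \<ge> 1"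
  shows "mdeg \<nu> + n = mdeg \<mu> + j" "mlen \<nu> + r = mlen \<mu> + 1"
proof -
  have s: "sum_list (map sgn (map int ls)) = int (length ls)"
    using assms(2) unfolding plists_def by (induction ls arbitrary: n r) auto
  have "0 \<notin> set (- int j # map int ls)" using assms(2,3) by (auto simp: plists_def)
  note * = Jlist_lookup_nonzero[OF this assms(1)[unfolded Jcoeff_def]]
  show "mdeg \<nu> + n = mdeg \<mu> + j"
    using *(1) assms(2) by (simp add: sum_list_map_int plists_def)
  show "mlen \<nu> + r = mlen \<mu> + 1"
    using *(2) assms(2,3) s by (simp add: plists_def)
qed

text \<open>Creation and annihilation operators are Hall adjoint, and taking the adjoint reverses
  the word. The reversal of \<open>ls\<close> disappears after summation over compositions, by
  \<open>sum_plists_rev\<close>.\<close>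

lemma Jcoeff_adjoint:
  assumes "ls \<in> plists n r" "j \<ge> 1"
  shows "mz \<mu> * Poly_Mapping.lookup (Poly_Mapping.single (sum_list (map p_mon ls)) 1
           * J (int j) (Poly_Mapping.single \<nu> 1)) \<mu> = mz \<nu> * Jcoeff \<nu> \<mu> j (rev ls)"
proof -
  let ?L = "map (\<lambda>l. - int l) ls @ [int j]"
  have 0: "0 \<notin> set ?L" using assms by (auto simp: plists_def)
  have "rev (map uminus ?L) = - int j # map int (rev ls)" by (simp add: rev_map o_def)
  with Jlist_adjoint[OF 0, of "Poly_Mapping.single \<nu> 1" "Poly_Mapping.single \<mu> 1"]
  have "hall (Jlist ?L (Poly_Mapping.single \<nu> 1)) (Poly_Mapping.single \<mu> 1) =
      hall (Poly_Mapping.single \<nu> 1) (Jlist (- int j # map int (rev ls)) (Poly_Mapping.single \<mu> 1))"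
    by simp
  thus ?thesis
    by (simp add: hall_single_right hall_single single_mult_eq_Jlist Jlist_append Jcoeff_def
        del: Jlist_Cons) simp
qed

lemma sum_plists_rev: "(\<Sum>ls\<in>plists n r. f (rev ls)) = (\<Sum>ls\<in>plists n r. f ls)"
  by (rule sum.reindex_bij_witness[of _ rev rev]) (auto simp: plists_def)

text \<open>Every summand of D is expanded in powers of P and moved across the Hall product. The
  bound \<open>B\<close> stays free so that the range of j can be matched with the one in
  \<open>Wcoeff_leading\<close>.\<close>

lemma Dop_matrix:
  assumes "mdeg \<nu> \<le> B"
  shows "mz \<mu> * Poly_Mapping.lookup (Dop h (Poly_Mapping.single \<nu> 1)) \<mu> =
    mz \<nu> * (\<Sum>j\<in>{1..B}. \<Sum>r\<le>j. \<Sum>k\<le>j. fps_nth (fps_nth h r) k * (\<Sum>ls\<in>plists (j - k) r. Jcoeff \<nu> \<mu> j ls))"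
proof -
  let ?p = "Poly_Mapping.single \<nu> 1 :: fock"
  have "Dop h ?p = (\<Sum>j\<in>{1..B}. Csym h j * J (int j) ?p)"
    using fvars_single[of \<nu>] assms by (intro Dop_superset) force+
  hence "mz \<mu> * Poly_Mapping.lookup (Dop h ?p) \<mu> =
    (\<Sum>j\<in>{1..B}. \<Sum>r\<le>j. \<Sum>k\<le>j. fps_nth (fps_nth h r) k * (\<Sum>ls\<in>plists (j - k) r.
       mz \<mu> * Poly_Mapping.lookup (Poly_Mapping.single (sum_list (map p_mon ls)) 1 * J (int j) ?p) \<mu>))"
    by (simp add: Csym_eq Pser_power_nth lookup_sum sum_distrib_right sum_distrib_left mult.assoc
        lookup_single_0_mult mult.left_commute[of "mz \<mu>"])
  also have "\<dots> = (\<Sum>j\<in>{1..B}. \<Sum>r\<le>j. \<Sum>k\<le>j. fps_nth (fps_nth h r) k *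
      (\<Sum>ls\<in>plists (j - k) r. mz \<nu> * Jcoeff \<nu> \<mu> j (rev ls)))"
    by (intro sum.cong refl arg_cong2[where f = "(*)"] Jcoeff_adjoint) auto
  also have "\<dots> = (\<Sum>j\<in>{1..B}. \<Sum>r\<le>j. \<Sum>k\<le>j. fps_nth (fps_nth h r) k *
      (mz \<nu> * (\<Sum>ls\<in>plists (j - k) r. Jcoeff \<nu> \<mu> j ls)))"
    by (simp only: flip: sum_distrib_left) (simp only: sum_plists_rev)
  finally show ?thesis by (simp add: sum_distrib_left mult.left_commute[of "mz \<nu>"])
qed

lemma Dop_matrix_0:
  assumes "\<not> (\<exists>k r. mdeg \<nu> = mdeg \<mu> + k \<and> mlen \<mu> + 1 = mlen \<nu> + r)"
  shows "mz \<mu> * Poly_Mapping.lookup (Dop h (Poly_Mapping.single \<nu> 1)) \<mu> = 0"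
proof -
  have "Jcoeff \<nu> \<mu> j ls = 0" if "ls \<in> plists (j - k) r" "j \<ge> 1" "k \<le> j" for j k r ls
  proof (rule ccontr)
    assume "Jcoeff \<nu> \<mu> j ls \<noteq> 0"
    from Jcoeff_nonzero[OF this that(1,2)] have "mdeg \<nu> = mdeg \<mu> + k" "mlen \<mu> + 1 = mlen \<nu> + r"
      using that by linarith+
    with assms show False by blast
  qed
  thus ?thesis by (subst Dop_matrix[OF order_refl]) (simp add: sum.neutral)
qed

lemma plists_empty: "r > n \<Longrightarrow> plists n r = {}"
proof -
  have "length ls \<le> sum_list ls" if "0 \<notin> set ls" for ls :: "nat list"
    using that by (induction ls) auto
  thus "r > n \<Longrightarrow> plists n r = {}" by (fastforce simp: plists_def)
qed

text \<open>The degree balance fixes the exponent k of z and the length balance fixes the exponent r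
  of s, so a single coefficient of \<open>h\<close> survives.\<close>

lemma Dop_matrix_leading:
  assumes k: "mdeg \<nu> = mdeg \<mu> + k" and r: "mlen \<mu> + 1 = mlen \<nu> + r" and B: "mdeg \<nu> \<le> B"
  shows "mz \<mu> * Poly_Mapping.lookup (Dop h (Poly_Mapping.single \<nu> 1)) \<mu> =
    mz \<nu> * fps_nth (fps_nth h r) k *
      (\<Sum>(j, ls)\<in>Sigma ({max 1 k..B}) (\<lambda>j. plists (j - k) r). Jcoeff \<nu> \<mu> j ls)"
proof -
  define t where "t j r k = (\<Sum>ls\<in>plists (j - k) r. Jcoeff \<nu> \<mu> j ls)" for j r k
  have t0: "t j r' k' = 0" if "(r', k') \<noteq> (r, k)" "j \<ge> 1" "k' \<le> j" for j r' k'
    unfolding t_def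
  proof (rule sum.neutral, rule ballI, rule ccontr)
    fix ls assume "ls \<in> plists (j - k') r'" "Jcoeff \<nu> \<mu> j ls \<noteq> 0"
    from Jcoeff_nonzero[OF this(2,1) that(2)] k r that show False by auto
  qed
  have "(\<Sum>r'\<le>j. \<Sum>k'\<le>j. fps_nth (fps_nth h r') k' * t j r' k') =
      (if k \<le> j then fps_nth (fps_nth h r) k * t j r k else 0)" if "j \<in> {1..B}" for j
  proof -
    have "(\<Sum>r'\<le>j. \<Sum>k'\<le>j. fps_nth (fps_nth h r') k' * t j r' k') =
       (\<Sum>r'\<le>j. \<Sum>k'\<le>j. if k' = k then if r' = r then fps_nth (fps_nth h r) k * t j r k else 0 else 0)"
      using t0 that by (intro sum.cong refl) auto
    also have "\<dots> = (if r \<le> j \<and> k \<le> j then fps_nth (fps_nth h r) k * t j r k else 0)"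
      by (cases "k \<le> j") simp_all
    \<comment> \<open>The condition \<open>r \<le> j\<close> can go: no composition of
      \<open>j - k\<close> has more than \<open>j - k\<close> parts.\<close>
    also have "\<dots> = (if k \<le> j then fps_nth (fps_nth h r) k * t j r k else 0)"
      using plists_empty[of "j - k" r] by (auto simp: t_def)
    finally show ?thesis .
  qed
  hence "(\<Sum>j\<in>{1..B}. \<Sum>r'\<le>j. \<Sum>k'\<le>j. fps_nth (fps_nth h r') k' * t j r' k') =
      (\<Sum>j\<in>{1..B}. if k \<le> j then fps_nth (fps_nth h r) k * t j r k else 0)"
    by (intro sum.cong) auto
  also have "\<dots> = (\<Sum>j\<in>{max 1 k..B}. fps_nth (fps_nth h r) k * t j r k)"
    by (rule sum.mono_neutral_cong_right) auto
  also have "\<dots> = fps_nth (fps_nth h r) k *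
      (\<Sum>(j, ls)\<in>Sigma ({max 1 k..B}) (\<lambda>j. plists (j - k) r). Jcoeff \<nu> \<mu> j ls)"
    by (simp add: t_def sum.Sigma flip: sum_distrib_left)
  finally show ?thesis unfolding Dop_matrix[OF B] t_def by (simp add: mult.assoc)
qed

section \<open>Words with exactly one creation operator\<close>

definition insert_neg :: "nat \<times> nat \<times> nat list \<Rightarrow> int list" where
  "insert_neg = (\<lambda>(i, j, ls). map int (take i ls) @ - int j # map int (drop i ls))"

lemma insert_neg_props:
  assumes "0 \<notin> set ls" "j \<ge> 1" "i \<le> length ls"
  shows "filter (\<lambda>x. x < 0) (insert_neg (i, j, ls)) = [- int j]"
    and "filter (\<lambda>x. x > 0) (insert_neg (i, j, ls)) = map int ls"
    and "takeWhile (\<lambda>x. x > 0) (insert_neg (i, j, ls)) = map int (take i ls)"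
    and "length (insert_neg (i, j, ls)) = Suc (length ls)"
    and "sum_list (insert_neg (i, j, ls)) = int (sum_list ls) - int j"
    and "0 \<notin> set (insert_neg (i, j, ls))"
    and "set (insert_neg (i, j, ls)) = insert (- int j) (int ` set ls)"
proof -
  define us vs where "us = take i ls" and "vs = drop i ls"
  have ls: "ls = us @ vs" by (simp add: us_def vs_def)
  have pos: "filter (\<lambda>x. x > 0) (map int xs) = map int xs" "filter (\<lambda>x. x < 0) (map int xs) = []"
    if "0 \<notin> set xs" for xs
    using that by (induction xs) auto
  have nz: "0 \<notin> set us" "0 \<notin> set vs" using assms(1) ls by auto
  have tw: "takeWhile (\<lambda>x. x > 0) (map int us @ - int j # map int vs) = map int us"
    using nz assms(2) by (subst takeWhile_append2) (auto intro: gr0I)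
  note I = insert_neg_def us_def[symmetric] vs_def[symmetric]
  show "filter (\<lambda>x. x < 0) (insert_neg (i, j, ls)) = [- int j]"
    and "filter (\<lambda>x. x > 0) (insert_neg (i, j, ls)) = map int ls"
    using nz assms(2) by (simp_all add: I pos) (simp add: ls)
  show "takeWhile (\<lambda>x. x > 0) (insert_neg (i, j, ls)) = map int (take i ls)"
    using tw by (simp add: I)
  show "length (insert_neg (i, j, ls)) = Suc (length ls)" by (simp add: I) (simp add: ls)
  show "sum_list (insert_neg (i, j, ls)) = int (sum_list ls) - int j"
    by (simp add: I sum_list_map_int) (simp add: ls)
  show "set (insert_neg (i, j, ls)) = insert (- int j) (int ` set ls)" by (simp add: I) (auto simp: ls)
  thus "0 \<notin> set (insert_neg (i, j, ls))" using assms by auto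
qed

text \<open>The lower bound by \<open>- B\<close> limits the negative entry, hence also the sum of
  the positive ones, and so makes the set finite.\<close>

definition neg1_lists :: "nat \<Rightarrow> nat \<Rightarrow> nat \<Rightarrow> int list set" where
  "neg1_lists k r B = {js. 0 \<notin> set js \<and> sum_list js = - int k \<and> length js = Suc r \<and> nneg js = 1 \<and>
     (\<forall>x\<in>set js. - int B \<le> x)}"

text \<open>Such a word amounts to the position of the negative entry, its value and the ordered
  positive entries. Injectivity holds because \<open>filter\<close> recovers the value and the
  positive entries, and \<open>takeWhile\<close> the position.\<close>

lemma bij_betw_insert_neg:
  "bij_betw insert_neg ({..r} \<times> Sigma ({max 1 k..B}) (\<lambda>j. plists (j - k) r)) (neg1_lists k r B)"
proof (rule bij_betw_imageI)
  let ?D = "{..r} \<times> Sigma ({max 1 k..B}) (\<lambda>j. plists (j - k) r)"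
  show "inj_on insert_neg ?D"
  proof (rule inj_onI)
    fix x x' assume **: "x \<in> ?D" "x' \<in> ?D" "insert_neg x = insert_neg x'"
    obtain i j ls i' j' ls' where x: "x = (i, j, ls)" "x' = (i', j', ls')" by (metis prod.exhaust)
    with ** have *: "insert_neg (i, j, ls) = insert_neg (i', j', ls')"
      and d: "i \<le> r" "i' \<le> r" "j \<in> {max 1 k..B}" "ls \<in> plists (j - k) r" "j' \<in> {max 1 k..B}" "ls' \<in> plists (j' - k) r"
      by auto
    have 1: "0 \<notin> set ls" "j \<ge> 1" "i \<le> length ls" and 2: "0 \<notin> set ls'" "j' \<ge> 1" "i' \<le> length ls'"
      using d by (auto simp: plists_def)
    note p = insert_neg_props(1-3)[OF 1] and p' = insert_neg_props(1-3)[OF 2]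
    have "[- int j] = [- int j']" "map int ls = map int ls'" "map int (take i ls) = map int (take i' ls')"
      using p p' unfolding * by metis+
    hence "j = j'" "ls = ls'" "length (take i ls) = length (take i' ls')"
      by (simp, simp add: inj_map_eq_map, metis length_map)
    thus "x = x'" using 1(3) 2(3) x by simp
  qed
  show "insert_neg ` ?D = neg1_lists k r B"
  proof safe
    fix i j ls assume d: "i \<le> r" "j \<in> {max 1 k..B}" "ls \<in> plists (j - k) r"
    hence 1: "0 \<notin> set ls" "j \<ge> 1" "i \<le> length ls" by (auto simp: plists_def)
    note p = insert_neg_props[OF 1]
    show "insert_neg (i, j, ls) \<in> neg1_lists k r B"
      unfolding neg1_lists_def mem_Collect_eq p(4,5,7) nneg_def p(1)
      using d 1 by (auto simp: plists_def)
  next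
    fix js assume js: "js \<in> neg1_lists k r B"
    hence "length (filter (\<lambda>x. x < 0) js) = 1" by (simp add: neg1_lists_def nneg_def)
    then obtain x where "filter (\<lambda>x. x < 0) js = [x]" by (metis One_nat_def length_0_conv length_Suc_conv)
    hence "\<exists>us vs. js = us @ x # vs \<and> (\<forall>u\<in>set us. \<not> u < 0) \<and> x < 0 \<and> [] = filter (\<lambda>x. x < 0) vs"
      by (simp only: filter_eq_Cons_iff)
    then obtain us vs where uv: "js = us @ x # vs" "\<forall>u\<in>set us. \<not> u < 0" "x < 0" "filter (\<lambda>x. x < 0) vs = []"
      by metis
    define j ls where "j = nat (- x)" and "ls = map nat (us @ vs)"
    have pos: "\<forall>u\<in>set (us @ vs). u > 0"
      using js uv by (auto simp: neg1_lists_def filter_empty_conv not_less order.order_iff_strict)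
    have x: "x = - int j" "j \<ge> 1" using uv(3) by (auto simp: j_def)
    have nn: "map int (map nat ws) = ws" if "\<forall>u\<in>set ws. u > 0" for ws
      using that by (induction ws) auto
    have js': "js = insert_neg (length us, j, ls)"
      using pos by (simp add: insert_neg_def ls_def uv(1) x(1) nn del: map_map)
    have "sum_list js = - int k" using js by (simp add: neg1_lists_def)
    moreover have "int (sum_list ls) = sum_list us + sum_list vs"
      using pos by (simp add: nn ls_def flip: sum_list_map_int del: map_map)
    ultimately have s: "int (sum_list ls) + int k = int j" using uv(1) x by simp
    have "\<forall>l\<in>set ls. l > 0" using pos by (auto simp: ls_def)
    hence "ls \<in> plists (j - k) r"
      using js s uv(1) by (auto simp: plists_def ls_def neg1_lists_def)
    moreover have "j \<in> {max 1 k..B}" "length us \<le> r" using js s x uv(1) by (auto simp: neg1_lists_def)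
    ultimately show "js \<in> insert_neg ` ?D" unfolding js' by blast
  qed
qed

text \<open>At the lowest order only words with one creator contribute, each with coefficient
  r!/(r+1)! = 1/(r+1). Normal ordering forgets where the creator stands, so its r + 1 possible
  positions cancel this factor.\<close>

lemma Wcoeff_leading:
  assumes k: "mdeg \<nu> = mdeg \<mu> + k" and r: "mlen \<mu> + 1 = mlen \<nu> + r"
  shows "Wcoeff k r \<nu> \<mu> =
      (\<Sum>(j, ls)\<in>Sigma ({max 1 k..mdeg \<mu> + mdeg \<nu>}) (\<lambda>j. plists (j - k) r). Jcoeff \<nu> \<mu> j ls)"
proof -
  define B where "B = mdeg \<mu> + mdeg \<nu>"
  let ?Q = "Sigma ({max 1 k..B}) (\<lambda>j. plists (j - k) r)"
  let ?S = "neg1_lists k r B"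
  define NO where "NO js = mat_of (normal_ordered js) \<nu> \<mu>" for js
  have finS: "finite ?S"
    using bij_betw_finite[OF bij_betw_insert_neg[of r k B]] by auto
  have "Wcoeff k r \<nu> \<mu> = (\<Sum>js\<in>(jlists k \<nu> \<mu> - {[]}) \<inter> ?S. NO js / of_nat (Suc r))"
    unfolding Wcoeff_def
  proof (rule sum.mono_neutral_cong_right)
    show "\<forall>js\<in>jlists k \<nu> \<mu> - {[]} - (jlists k \<nu> \<mu> - {[]}) \<inter> ?S.
        fact r / fact (length js) * fls_nth (bos_coeff js) (int r) * mat_of (normal_ordered js) \<nu> \<mu> = 0"
    proof (intro ballI, rule ccontr)
      fix js assume js: "js \<in> jlists k \<nu> \<mu> - {[]} - (jlists k \<nu> \<mu> - {[]}) \<inter> ?S"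
        and nz: "fact r / fact (length js) * fls_nth (bos_coeff js) (int r) * mat_of (normal_ordered js) \<nu> \<mu> \<noteq> 0"
      have js': "0 \<notin> set js" "sum_list js = - int k" "js \<noteq> []" using js by (auto simp: jlists_def)
      have "length js \<le> r + 1"
        using fls_lead_bos_coeff[OF js'(1)] nz by (force simp: fls_lead_def)
      moreover have "nneg js \<ge> 1" by (rule nneg_ge_1) (use js' in auto)
      moreover have "int (mlen \<nu>) + int (length js) = int (mlen \<mu>) + 2 * int (nneg js)"
        by (rule normal_ordered_nonzero(2)[OF js'(1)]) (use nz in auto)
      \<comment> \<open>The length balance reads \<open>length js = r - 1 + 2 * nneg js\<close>, so
        the upper bound on the length and the lower bound on the creators are both attained.\<close>
      ultimately have "length js = Suc r" "nneg js = 1" using r by linarith+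
      hence "js \<in> ?S" using js js' by (auto simp: neg1_lists_def jlists_def B_def)
      with js show False by auto
    qed
    fix js assume "js \<in> (jlists k \<nu> \<mu> - {[]}) \<inter> ?S"
    hence "0 \<notin> set js" "length js = Suc r" by (auto simp: neg1_lists_def)
    with fls_lead_bos_coeff[of js] show "fact r / fact (length js) * fls_nth (bos_coeff js) (int r) *
        mat_of (normal_ordered js) \<nu> \<mu> = NO js / of_nat (Suc r)"
      by (simp add: fls_lead_def NO_def)
  qed auto
  \<comment> \<open>The words added here lie outside \<open>jlists\<close>, so their matrix entries
    vanish.\<close>
  also have "\<dots> = (\<Sum>js\<in>?S. NO js / of_nat (Suc r))"
  proof (rule sum.mono_neutral_left[OF finS], simp, intro ballI, rule ccontr)
    fix js assume js: "js \<in> ?S - (jlists k \<nu> \<mu> - {[]}) \<inter> ?S" and nz: "NO js / of_nat (Suc r) \<noteq> 0"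
    hence "js \<in> jlists k \<nu> \<mu> - {[]}"
      using normal_ordered_nonzero(3,4)[of js \<nu> \<mu>] by (auto simp: NO_def neg1_lists_def jlists_def)
    with js show False by auto
  qed
  also have "\<dots> = (\<Sum>x\<in>{..r} \<times> ?Q. NO (insert_neg x) / of_nat (Suc r))"
    by (rule sum.reindex_bij_betw[OF bij_betw_insert_neg, symmetric])
  also have "\<dots> = (\<Sum>(i, x)\<in>{..r} \<times> ?Q. (case x of (j, ls) \<Rightarrow> Jcoeff \<nu> \<mu> j ls) / of_nat (Suc r))"
  proof (rule sum.cong, safe)
    fix i j ls assume d: "i \<le> r" "j \<in> {max 1 k..B}" "ls \<in> plists (j - k) r"
    hence 1: "0 \<notin> set ls" "j \<ge> 1" "i \<le> length ls" by (auto simp: plists_def)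
    show "NO (insert_neg (i, j, ls)) / of_nat (Suc r) = Jcoeff \<nu> \<mu> j ls / of_nat (Suc r)"
      using insert_neg_props[OF 1] by (simp add: NO_def mat_of_def normal_ordered_eq Jcoeff_def)
  qed
  also have "\<dots> = (\<Sum>(j, ls)\<in>?Q. Jcoeff \<nu> \<mu> j ls)"
    by (subst sum.cartesian_product[symmetric]) (simp add: sum_divide_distrib[symmetric] del: of_nat_Suc)
  finally show ?thesis by (simp add: B_def)
qed

text \<open>Matrix of the Hall adjoint of \<open>Dop h\<close>: the weights \<open>mz\<close> turn
  the transpose into the adjoint.\<close>

definition Tmat :: "series_zs \<Rightarrow> complex fmat" where
  "Tmat h \<nu> \<mu> = mz \<mu> * Poly_Mapping.lookup (Dop h (Poly_Mapping.single \<nu> 1)) \<mu> / mz \<nu>"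

lemma fls_lead_cut_join:
  assumes "cut_join_symbol w"
  shows "fls_lead (int (mlen \<mu>) - int (mlen \<nu>)) (Tmat (leading_symbol w) \<nu> \<mu>) (cut_join w \<nu> \<mu>)"
proof -
  have "fls_nth (cut_join w \<nu> \<mu>) (int (mlen \<mu>) - int (mlen \<nu>)) = Tmat (leading_symbol w) \<nu> \<mu>"
  proof (cases "\<exists>k r. mdeg \<nu> = mdeg \<mu> + k \<and> mlen \<mu> + 1 = mlen \<nu> + r")
    case True
    then obtain k r where kr: "mdeg \<nu> = mdeg \<mu> + k" "mlen \<mu> + 1 = mlen \<nu> + r" by blast
    show ?thesis
      unfolding cut_join_leading[OF assms kr] Wcoeff_leading[OF kr] Tmat_def
      by (subst Dop_matrix_leading[OF kr, of "mdeg \<mu> + mdeg \<nu>"]) auto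
  next
    case False
    show ?thesis
      unfolding cut_join_leading_0[OF assms False] Tmat_def Dop_matrix_0[OF False] by simp
  qed
  thus ?thesis using cut_join_below[OF assms] by (auto simp: fls_lead_def)
qed

section \<open>Convergence of exponentials on finite index sets\<close>

lemma iterate_bound:
  fixes f :: "nat \<Rightarrow> 'i \<Rightarrow> complex"
  assumes "finite F" and rec: "\<And>n x. x \<in> F \<Longrightarrow> f (Suc n) x = (\<Sum>y\<in>F. M x y * f n y)"
  obtains B C where "\<And>n x. x \<in> F \<Longrightarrow> norm (f n x) \<le> C * B ^ n" "B \<ge> 0"
proof -
  \<comment> \<open>\<open>B\<close> dominates every row sum of absolute values of \<open>M\<close>,
    so it bounds the operator norm of \<open>M\<close> for the maximum norm.\<close>
  define B where "B = (\<Sum>x\<in>F. \<Sum>y\<in>F. norm (M x y))"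
  define C where "C = (\<Sum>x\<in>F. norm (f 0 x))"
  have B0: "B \<ge> 0" and C0: "C \<ge> 0" by (auto simp: B_def C_def intro!: sum_nonneg)
  have "norm (f n x) \<le> C * B ^ n" if "x \<in> F" for n x
    using that
  proof (induction n arbitrary: x)
    case 0
    thus ?case using assms(1) member_le_sum[of x F "\<lambda>x. norm (f 0 x)"] by (simp add: C_def)
  next
    case (Suc n)
    have "norm (f (Suc n) x) \<le> (\<Sum>y\<in>F. norm (M x y) * norm (f n y))"
      unfolding rec[OF Suc.prems] by (rule order_trans[OF norm_sum]) (simp add: norm_mult)
    also have "\<dots> \<le> (\<Sum>y\<in>F. norm (M x y) * (C * B ^ n))"
      by (intro sum_mono mult_left_mono Suc.IH) auto
    also have "\<dots> = (\<Sum>y\<in>F. norm (M x y)) * (C * B ^ n)" by (simp add: sum_distrib_right)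
    also have "\<dots> \<le> B * (C * B ^ n)"
      unfolding B_def using Suc.prems assms(1) B0 C0
      by (intro mult_right_mono member_le_sum) (auto simp: B_def intro!: sum_nonneg)
    finally show ?case by (simp add: mult_ac)
  qed
  with B0 show ?thesis using that by blast
qed

text \<open>Geometric growth of the iterates against the factorial: comparison with the exponential
  series.\<close>

lemma summable_iterates:
  fixes f :: "nat \<Rightarrow> 'i \<Rightarrow> complex"
  assumes "finite F" "\<And>n x. x \<in> F \<Longrightarrow> f (Suc n) x = (\<Sum>y\<in>F. M x y * f n y)" "x \<in> F"
  shows "summable (\<lambda>n. norm (f n x / fact n))"
proof -
  obtain B C where BC: "\<And>n x. x \<in> F \<Longrightarrow> norm (f n x) \<le> C * B ^ n" "B \<ge> 0"
    using iterate_bound[of F f M] assms(1,2) by metis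
  have "summable (\<lambda>n. C * (B ^ n / fact n))"
    using summable_exp[of B] by (intro summable_mult) (simp add: field_simps)
  thus ?thesis
  proof (rule summable_comparison_test')
    fix n
    show "norm (norm (f n x / fact n)) \<le> C * (B ^ n / fact n)"
      using BC(1)[OF assms(3), of n] divide_right_mono[of "norm (f n x)" "C * B ^ n" "fact n"]
      by (simp add: norm_divide)
  qed
qed

lemma Dop_scale: "Dop h (Poly_Mapping.single 0 c * f) = Poly_Mapping.single 0 c * Dop h f"
  by (simp add: derivation_mult[OF derivation_Dop] Dop_const)

lemma Dop_iter_scale:
  "(Dop h ^^ n) (Poly_Mapping.single 0 c * f) = Poly_Mapping.single 0 c * (Dop h ^^ n) f"
  by (induction n) (auto simp: Dop_scale)

lemma Dop_iter_sum: "(Dop h ^^ n) (sum g A) = (\<Sum>x\<in>A. (Dop h ^^ n) (g x))"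
  by (induction n) (auto simp: derivation_sum[OF derivation_Dop])

lemma lookup_Dop_iter:
  assumes "finite A" "Poly_Mapping.keys f \<subseteq> A"
  shows "Poly_Mapping.lookup ((Dop h ^^ n) f) \<mu> =
    (\<Sum>\<kappa>\<in>A. Poly_Mapping.lookup f \<kappa> * Poly_Mapping.lookup ((Dop h ^^ n) (Poly_Mapping.single \<kappa> 1)) \<mu>)"
proof -
  have "f = (\<Sum>\<kappa>\<in>Poly_Mapping.keys f. Poly_Mapping.single \<kappa> (Poly_Mapping.lookup f \<kappa>))"
    by (rule poly_mapping_expansion)
  also have "\<dots> = (\<Sum>\<kappa>\<in>A. Poly_Mapping.single \<kappa> (Poly_Mapping.lookup f \<kappa>))"
    using assms by (intro sum.mono_neutral_left) (auto simp: in_keys_iff)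
  finally have "f = (\<Sum>\<kappa>\<in>A. Poly_Mapping.single 0 (Poly_Mapping.lookup f \<kappa>) * Poly_Mapping.single \<kappa> 1)"
    by (simp add: mult_single)
  hence "(Dop h ^^ n) f = (\<Sum>\<kappa>\<in>A. Poly_Mapping.single 0 (Poly_Mapping.lookup f \<kappa>) *
      (Dop h ^^ n) (Poly_Mapping.single \<kappa> 1))"
    by (metis (no_types, lifting) Dop_iter_sum Dop_iter_scale sum.cong)
  thus ?thesis by (simp add: lookup_sum lookup_single_0_mult)
qed

text \<open>A term z^k s^r of \<open>h\<close> contributes a polynomial of degree j - k to the
  coefficient of z^j, while J_j removes degree j.\<close>

lemma keys_Dop_single: "\<kappa> \<in> Poly_Mapping.keys (Dop h (Poly_Mapping.single \<nu> 1)) \<Longrightarrow> mdeg \<kappa> \<le> mdeg \<nu>"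
proof (rule ccontr)
  assume *: "\<kappa> \<in> Poly_Mapping.keys (Dop h (Poly_Mapping.single \<nu> 1))" "\<not> mdeg \<kappa> \<le> mdeg \<nu>"
  hence "mz \<kappa> * Poly_Mapping.lookup (Dop h (Poly_Mapping.single \<nu> 1)) \<kappa> = 0"
    by (intro Dop_matrix_0) auto
  with *(1) show False by (simp add: in_keys_iff)
qed

lemma keys_Dop_iter:
  assumes "\<And>\<mu>. \<mu> \<in> Poly_Mapping.keys f \<Longrightarrow> mdeg \<mu> \<le> d" "\<mu> \<in> Poly_Mapping.keys ((Dop h ^^ n) f)"
  shows "mdeg \<mu> \<le> d"
  using assms(2)
proof (induction n arbitrary: \<mu>)
  case (Suc n)
  have "Poly_Mapping.lookup (Dop h ((Dop h ^^ n) f)) \<mu> \<noteq> 0"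
    using Suc.prems by (simp add: in_keys_iff)
  moreover have "Poly_Mapping.lookup (Dop h ((Dop h ^^ n) f)) \<mu> =
      (\<Sum>\<kappa>\<in>Poly_Mapping.keys ((Dop h ^^ n) f). Poly_Mapping.lookup ((Dop h ^^ n) f) \<kappa> *
        Poly_Mapping.lookup (Dop h (Poly_Mapping.single \<kappa> 1)) \<mu>)"
    using lookup_Dop_iter[of "Poly_Mapping.keys ((Dop h ^^ n) f)" "(Dop h ^^ n) f" 1 h \<mu>] by simp
  ultimately obtain \<kappa> where "\<kappa> \<in> Poly_Mapping.keys ((Dop h ^^ n) f)"
      "Poly_Mapping.lookup (Dop h (Poly_Mapping.single \<kappa> 1)) \<mu> \<noteq> 0"
    by (metis (mono_tags, lifting) mult_zero_right sum.neutral)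
  thus ?case using Suc.IH keys_Dop_single[of \<mu> h \<kappa>] by (force simp: in_keys_iff)
qed (use assms in auto)

text \<open>D acts on the finite-dimensional space of degree at most d, where
  \<open>summable_iterates\<close> applies.\<close>

lemma summable_Dop_iter: "summable (\<lambda>n. norm (Poly_Mapping.lookup ((Dop h ^^ n) f) \<mu> / fact n))"
proof -
  \<comment> \<open>The degree of \<mu> is included so that \<mu> is an index of the finite system
    even when it does not occur in \<open>f\<close>.\<close>
  define d where "d = Max (insert (mdeg \<mu>) (mdeg ` Poly_Mapping.keys f))"
  have d: "mdeg \<kappa> \<le> d" if "\<kappa> \<in> Poly_Mapping.keys f" for \<kappa> using that by (auto simp: d_def)
  have "mdeg \<mu> \<le> d" by (auto simp: d_def)
  have "Poly_Mapping.lookup ((Dop h ^^ Suc n) f) \<nu> = (\<Sum>\<kappa>\<in>{\<kappa>. mdeg \<kappa> \<le> d}.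
      Poly_Mapping.lookup (Dop h (Poly_Mapping.single \<kappa> 1)) \<nu> * Poly_Mapping.lookup ((Dop h ^^ n) f) \<kappa>)" for n \<nu>
    using lookup_Dop_iter[OF finite_mdeg_le, of "(Dop h ^^ n) f" d 1 h \<nu>] keys_Dop_iter[of f d _ n h] d
    by (auto simp: mult.commute)
  from summable_iterates[OF finite_mdeg_le[of d], where f = "\<lambda>n \<mu>. Poly_Mapping.lookup ((Dop h ^^ n) f) \<mu>" and x = \<mu>, OF this] \<open>mdeg \<mu> \<le> d\<close> show ?thesis by simp
qed

section \<open>Exponential of the cut-and-join operator\<close>

lemma fls_lead_sum:
  "(\<And>x. x \<in> A \<Longrightarrow> fls_lead n (c x) (f x)) \<Longrightarrow> fls_lead n (\<Sum>x\<in>A. c x) (\<Sum>x\<in>A. f x)"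
  by (auto simp: fls_lead_def fls_nth_sum intro!: sum.neutral sum.cong)

lemma fls_const_sum: "fls_const (sum f A) = (\<Sum>x\<in>A. fls_const (f x))"
  by (induction A rule: infinite_finite_induct) (auto simp flip: fls_plus_const)

lemma cut_join_eq_0: "cut_join_symbol w \<Longrightarrow> mdeg \<nu> < mdeg \<mu> \<Longrightarrow> cut_join w \<nu> \<mu> = 0"
  by (intro fls_eqI) (simp add: cut_join_below)

text \<open>The lowest orders of the two factors add up to the same number for every intermediate
  monomial \<kappa>. Hence passing to the part of weight 0 is multiplicative, and the i-th power of
  W yields the adjoint of the i-th power of D.\<close>

lemma fls_lead_cut_join_power:
  fixes w defines "h \<equiv> leading_symbol w"
  assumes w: "cut_join_symbol w"
  shows "fls_lead (int (mlen \<mu>) - int (mlen \<nu>))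
      (mz \<mu> * Poly_Mapping.lookup ((Dop h ^^ i) (Poly_Mapping.single \<nu> 1)) \<mu> / mz \<nu>)
      (fmat_power (cut_join w) i \<nu> \<mu>) \<and>
    (mdeg \<nu> < mdeg \<mu> \<longrightarrow> fmat_power (cut_join w) i \<nu> \<mu> = 0)"
proof (induction i arbitrary: \<nu>)
  case 0
  show ?case
    by (cases "\<nu> = \<mu>") (simp_all add: fls_lead_def fmat_one_def lookup_single when_def)
next
  case (Suc i)
  let ?A = "{\<kappa>. mdeg \<kappa> \<le> mdeg \<nu>}"
  have "fmat_power (cut_join w) (Suc i) \<nu> \<mu> = (\<Sum>\<kappa>\<in>?A. cut_join w \<nu> \<kappa> * fmat_power (cut_join w) i \<kappa> \<mu>)"
    unfolding fmat_power.simps fmat_mult_def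
    by (rule Sum_any.expand_superset[OF finite_mdeg_le]) (use cut_join_eq_0[OF w, of \<nu>] in \<open>force simp: not_le\<close>)
  moreover have "fls_lead (int (mlen \<mu>) - int (mlen \<nu>))
      (\<Sum>\<kappa>\<in>?A. Tmat h \<nu> \<kappa> * (mz \<mu> * Poly_Mapping.lookup ((Dop h ^^ i) (Poly_Mapping.single \<kappa> 1)) \<mu> / mz \<kappa>))
      (\<Sum>\<kappa>\<in>?A. cut_join w \<nu> \<kappa> * fmat_power (cut_join w) i \<kappa> \<mu>)"
  proof (rule fls_lead_sum)
    fix \<kappa>
    from fls_lead_mult[OF fls_lead_cut_join[OF w] conjunct1[OF Suc.IH], of \<kappa> \<nu> \<kappa>]
    show "fls_lead (int (mlen \<mu>) - int (mlen \<nu>))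
      (Tmat h \<nu> \<kappa> * (mz \<mu> * Poly_Mapping.lookup ((Dop h ^^ i) (Poly_Mapping.single \<kappa> 1)) \<mu> / mz \<kappa>))
      (cut_join w \<nu> \<kappa> * fmat_power (cut_join w) i \<kappa> \<mu>)" by (simp add: h_def)
  qed
  moreover have "(\<Sum>\<kappa>\<in>?A. Tmat h \<nu> \<kappa> * (mz \<mu> * Poly_Mapping.lookup ((Dop h ^^ i) (Poly_Mapping.single \<kappa> 1)) \<mu> / mz \<kappa>)) =
      mz \<mu> * Poly_Mapping.lookup ((Dop h ^^ Suc i) (Poly_Mapping.single \<nu> 1)) \<mu> / mz \<nu>"
    \<comment> \<open>The additional D acts first, on the monomial \<nu>, because adjoints reverse
      the order of composition.\<close>
    unfolding funpow_Suc_right comp_def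
    by (subst lookup_Dop_iter[OF finite_mdeg_le, of _ "mdeg \<nu>"])
       (auto simp: keys_Dop_single Tmat_def sum_distrib_left sum_divide_distrib intro!: sum.cong)
  moreover have "(\<Sum>\<kappa>\<in>?A. cut_join w \<nu> \<kappa> * fmat_power (cut_join w) i \<kappa> \<mu>) = 0" if "mdeg \<nu> < mdeg \<mu>"
    using that Suc.IH by (intro sum.neutral) auto
  ultimately show ?case by simp
qed

text \<open>All powers share one lower bound for the order in the Laurent variable, so the
  coefficientwise sums again form a Laurent series.\<close>

lemma fls_nth_exp_cut_join:
  assumes w: "cut_join_symbol w"
  shows "fls_nth (fmat_exp (cut_join w) \<nu> \<mu>) n = suminf (\<lambda>i. fls_nth (fmat_power (cut_join w) i \<nu> \<mu>) n / fact i)"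
  unfolding fmat_exp_def
proof (rule nth_Abs_fls_lower_bound[of "int (mlen \<mu>) - int (mlen \<nu>)"], intro allI impI)
  fix n assume "n < int (mlen \<mu>) - int (mlen \<nu>)"
  with fls_lead_cut_join_power[OF w, of \<mu> \<nu>] have "fls_nth (fmat_power (cut_join w) i \<nu> \<mu>) n = 0" for i
    by (auto simp: fls_lead_def)
  thus "suminf (\<lambda>i. fls_nth (fmat_power (cut_join w) i \<nu> \<mu>) n / fact i) = 0" by simp
qed

definition Dexp :: "series_zs \<Rightarrow> fock \<Rightarrow> mon \<Rightarrow> complex" where
  "Dexp h f \<mu> = suminf (\<lambda>i. Poly_Mapping.lookup ((Dop h ^^ i) f) \<mu> / fact i)"

lemma fls_lead_exp_cut_join:
  assumes w: "cut_join_symbol w"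
  shows "fls_lead (int (mlen \<mu>) - int (mlen \<nu>))
      (mz \<mu> / mz \<nu> * Dexp (leading_symbol w) (Poly_Mapping.single \<nu> 1) \<mu>)
      (fmat_exp (cut_join w) \<nu> \<mu>)"
proof -
  note l = conjunct1[OF fls_lead_cut_join_power[OF w, of \<mu> \<nu>], unfolded fls_lead_def]
  let ?x = "\<lambda>i. Poly_Mapping.lookup ((Dop (leading_symbol w) ^^ i) (Poly_Mapping.single \<nu> 1)) \<mu> / fact i"
  have "fls_nth (fmat_exp (cut_join w) \<nu> \<mu>) (int (mlen \<mu>) - int (mlen \<nu>)) = suminf (\<lambda>i. mz \<mu> / mz \<nu> * ?x i)"
    using l by (simp add: fls_nth_exp_cut_join[OF w])
  also have "\<dots> = mz \<mu> / mz \<nu> * suminf ?x"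
    by (rule suminf_mult[OF summable_norm_cancel[OF summable_Dop_iter]])
  finally show ?thesis
    using l by (simp add: fls_lead_def fls_nth_exp_cut_join[OF w] Dexp_def)
qed

lemma exp_cut_join_eq_0:
  assumes "cut_join_symbol w" "mdeg \<nu> < mdeg \<mu>"
  shows "fmat_exp (cut_join w) \<nu> \<mu> = 0"
  using fls_lead_cut_join_power[OF assms(1), of \<mu> \<nu>] assms
  by (intro fls_eqI) (simp add: fls_nth_exp_cut_join[OF assms(1)])

text \<open>Coefficient of the monomial \<mu> in the exponential of sum_q s_q p_q / q, with the
  power of the Laurent variable set aside.\<close>

definition src_coeff :: "(nat \<Rightarrow> 'k::field) \<Rightarrow> mon \<Rightarrow> 'k" where
  "src_coeff s \<mu> = mval (\<lambda>q. s q / of_nat q) \<mu> / of_nat (mfact \<mu>)"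

context
  fixes \<iota> :: "complex \<Rightarrow> 'k::field"
  assumes \<iota>: "field_embedding \<iota>"
begin

lemma emb_add: "\<iota> (a + b) = \<iota> a + \<iota> b" and emb_mult: "\<iota> (a * b) = \<iota> a * \<iota> b" and emb_1: "\<iota> 1 = 1"
  using \<iota> by (auto simp: field_embedding_def)

lemma emb_0: "\<iota> 0 = 0"
  using emb_add[of 0 0] by (simp only: add_0_right add_cancel_right_right)

lemma emb_eq_0_iff: "\<iota> a = 0 \<longleftrightarrow> a = 0"
  using emb_mult[of a "inverse a"] emb_1 emb_0 by (cases "a = 0") auto

lemma emb_of_nat: "\<iota> (of_nat n) = of_nat n"
  by (induction n) (auto simp: emb_0 emb_1 emb_add)

lemma emb_divide: "\<iota> (a / b) = \<iota> a / \<iota> b"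
proof (cases "b = 0")
  case False
  hence "\<iota> a = \<iota> (a / b) * \<iota> b" by (simp flip: emb_mult)
  thus ?thesis using False emb_eq_0_iff by (simp add: field_simps)
qed (simp add: emb_0)

text \<open>The field inherits characteristic 0 from the complex numbers; divisions by indices and
  factorials rely on this.\<close>

lemma of_nat_emb_eq_0_iff: "(of_nat n :: 'k) = 0 \<longleftrightarrow> n = 0"
  using emb_eq_0_iff[of "of_nat n"] by (simp add: emb_of_nat)

lemma fls_nth_map: "fls_nth (fls_map \<iota> f) n = \<iota> (fls_nth f n)"
proof -
  have "\<forall>\<^sub>\<infinity>n. \<iota> (fls_nth f (- int n)) = 0"
    by (rule eventually_mono[OF MOST_fls_neg_nth_eq_0[of f]]) (simp add: emb_0)
  thus ?thesis unfolding fls_map_def by simp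
qed

section \<open>The correlators\<close>

lemma mat_of_J_neg: "mat_of (J (- int q)) \<nu> \<mu> = (if \<nu> = \<mu> + p_mon q then 1 else 0)"
  by (auto simp: mat_of_def J_neg_single lookup_single when_def)

lemma source_p_mon:
  assumes "q \<ge> 1"
  shows "source \<iota> s (\<kappa> + p_mon q) \<kappa> = fls_const (s q / of_nat q) * fls_X_inv"
proof -
  have "(if q' \<ge> 1 then fls_const (s q' / of_nat q') * fls_X_inv *
      fls_const (\<iota> (mat_of (J (- int q')) (\<kappa> + p_mon q) \<kappa>)) else 0) =
     (if q' = q then fls_const (s q / of_nat q) * fls_X_inv else 0)" for q'
    using assms p_mon_inject[of q q'] by (auto simp: mat_of_J_neg emb_0 emb_1)
  thus ?thesis unfolding source_def by simp
qed

lemma source_nonzero: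
  assumes "source \<iota> s \<mu> \<kappa> \<noteq> 0"
  shows "\<exists>q\<in>Suc ` Poly_Mapping.keys \<mu>. \<kappa> = \<mu> - p_mon q"
proof -
  from assms[unfolded source_def] obtain q where "(if q \<ge> 1 then fls_const (s q / of_nat q) * fls_X_inv *
      fls_const (\<iota> (mat_of (J (- int q)) \<mu> \<kappa>)) else 0) \<noteq> 0"
    by (rule Sum_any.not_neutral_obtains_not_neutral)
  hence "q \<ge> 1" "\<mu> = \<kappa> + p_mon q"
    by (auto simp: mat_of_J_neg emb_0 split: if_splits)
  thus ?thesis by (intro bexI[of _ q]) (auto simp: keys_add_nat image_iff intro: exI[of _ "q - 1"])
qed

text \<open>This is the differential equation of the source: d/dp_q multiplies the exponential by
  s_q / q.\<close>

lemma src_coeff_p_mon: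
  fixes s :: "nat \<Rightarrow> 'k"
  assumes "q \<ge> 1"
  shows "s q / of_nat q * src_coeff s \<kappa> = of_nat (Suc (Poly_Mapping.lookup \<kappa> (q - 1))) * src_coeff s (\<kappa> + p_mon q)"
proof -
  define n where "n = Suc (Poly_Mapping.lookup \<kappa> (q - 1))"
  have "(of_nat n :: 'k) \<noteq> 0" using of_nat_emb_eq_0_iff[of n] by (simp add: n_def)
  moreover have "mfact (\<kappa> + p_mon q) = n * mfact \<kappa>" by (simp add: mfact_add_p_mon n_def)
  ultimately show ?thesis
    unfolding n_def[symmetric] using assms by (simp add: src_coeff_def mval_add mval_p_mon)
qed

lemma source_power:
  "fmat_power (source \<iota> s) i \<mu> 0 =
    (if mlen \<mu> = i then fls_const (of_nat (fact i) * src_coeff s \<mu>) * fls_X_inv ^ i else 0)"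
proof (induction i arbitrary: \<mu>)
  case 0
  have "mlen \<mu> = 0 \<longleftrightarrow> \<mu> = 0"
    by (auto simp: mlen_def in_keys_iff intro!: poly_mapping_eqI)
  thus ?case by (auto simp: fmat_one_def src_coeff_def)
next
  case (Suc i)
  let ?Q = "Suc ` Poly_Mapping.keys \<mu>"
  let ?f = "\<lambda>q. \<mu> - p_mon q"
  have split: "\<mu> = ?f q + p_mon q" if "q \<in> ?Q" for q
    using that p_mon_split[of \<mu> q] by (auto simp: in_keys_iff)
  have inj: "inj_on ?f ?Q"
  proof (rule inj_onI)
    fix q q' assume "q \<in> ?Q" "q' \<in> ?Q" "?f q = ?f q'"
    with split[of q] split[of q'] have "p_mon q = p_mon q'" by (metis add_left_cancel)
    with \<open>q \<in> ?Q\<close> \<open>q' \<in> ?Q\<close> show "q = q'" using p_mon_inject[of q q'] by auto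
  qed
  have "fmat_power (source \<iota> s) (Suc i) \<mu> 0 = (\<Sum>\<kappa>\<in>?f ` ?Q. source \<iota> s \<mu> \<kappa> * fmat_power (source \<iota> s) i \<kappa> 0)"
    unfolding fmat_power.simps fmat_mult_def
  proof (rule Sum_any.expand_superset)
    show "{\<kappa>. source \<iota> s \<mu> \<kappa> * fmat_power (source \<iota> s) i \<kappa> 0 \<noteq> 0} \<subseteq> ?f ` ?Q"
      using source_nonzero[of s \<mu>] by (auto simp: image_iff)
  qed simp
  also have "\<dots> = (\<Sum>q\<in>?Q. source \<iota> s \<mu> (?f q) * fmat_power (source \<iota> s) i (?f q) 0)"
    using inj by (simp add: sum.reindex)
  also have "\<dots> = (\<Sum>q\<in>?Q. if mlen \<mu> = Suc i then
      fls_const (of_nat (fact i) * (of_nat (Poly_Mapping.lookup \<mu> (q - 1)) * src_coeff s \<mu>)) * fls_X_inv ^ Suc i else 0)"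
  proof (intro sum.cong refl)
    fix q assume q: "q \<in> ?Q"
    hence q1: "q \<ge> 1" by auto
    define \<kappa> where "\<kappa> = ?f q"
    have \<mu>: "\<mu> = \<kappa> + p_mon q" using split[OF q] by (simp add: \<kappa>_def)
    have "source \<iota> s \<mu> \<kappa> * fmat_power (source \<iota> s) i \<kappa> 0 = (if mlen \<mu> = Suc i then
      fls_const (s q / of_nat q) * fls_X_inv * (fls_const (of_nat (fact i) * src_coeff s \<kappa>) * fls_X_inv ^ i) else 0)"
      unfolding \<mu> source_p_mon[OF q1] Suc by (simp add: mlen_add)
    also have "fls_const (s q / of_nat q) * fls_X_inv * (fls_const (of_nat (fact i) * src_coeff s \<kappa>) * fls_X_inv ^ i) =
       fls_const (of_nat (fact i) * (s q / of_nat q * src_coeff s \<kappa>)) * fls_X_inv ^ Suc i"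
      by (simp only: fls_const_mult_const[symmetric] power_Suc mult_ac)
    also have "s q / of_nat q * src_coeff s \<kappa> = of_nat (Poly_Mapping.lookup \<mu> (q - 1)) * src_coeff s \<mu>"
      unfolding src_coeff_p_mon[OF q1] \<mu> by (simp add: lookup_add lookup_p_mon)
    finally show "source \<iota> s \<mu> (?f q) * fmat_power (source \<iota> s) i (?f q) 0 = (if mlen \<mu> = Suc i then
      fls_const (of_nat (fact i) * (of_nat (Poly_Mapping.lookup \<mu> (q - 1)) * src_coeff s \<mu>)) * fls_X_inv ^ Suc i else 0)"
      by (simp add: \<kappa>_def)
  qed
  also have "\<dots> = (if mlen \<mu> = Suc i then
      fls_const (of_nat (fact i) * ((\<Sum>q\<in>?Q. of_nat (Poly_Mapping.lookup \<mu> (q - 1))) * src_coeff s \<mu>)) * fls_X_inv ^ Suc i else 0)"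
    unfolding sum_distrib_right sum_distrib_left fls_const_sum by simp
  \<comment> \<open>The multiplicities add up to the length of \<mu>, which is \<open>Suc i\<close>;
    this turns the factorial of \<open>i\<close> into that of \<open>Suc i\<close>.\<close>
  also have "(\<Sum>q\<in>?Q. of_nat (Poly_Mapping.lookup \<mu> (q - 1)) :: 'k) = of_nat (mlen \<mu>)"
    by (simp add: sum.reindex mlen_def)
  finally show ?case by (simp add: algebra_simps)
qed

lemma exp_source:
  "fmat_exp_nil (source \<iota> s) \<mu> 0 = fls_const (src_coeff s \<mu>) * fls_X_inv ^ mlen \<mu>"
proof -
  have "of_nat (fact n) \<noteq> (0::'k)" for n using of_nat_emb_eq_0_iff[of "fact n"] by simp
  hence "fls_const (1 / of_nat (fact i)) * fmat_power (source \<iota> s) i \<mu> 0 =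
      (if i = mlen \<mu> then fls_const (src_coeff s \<mu>) * fls_X_inv ^ mlen \<mu> else 0)" for i
    by (auto simp: source_power simp flip: mult.assoc)
  thus ?thesis unfolding fmat_exp_nil_def by simp
qed

lemma mat_of_J_pos: "m \<ge> 1 \<Longrightarrow> mat_of (J (int m)) 0 \<kappa> = (if \<kappa> = p_mon m then of_nat m else 0)"
proof -
  assume m: "m \<ge> 1"
  have "\<kappa> = p_mon m" if "\<kappa> - p_mon m = 0" "Poly_Mapping.lookup \<kappa> (m - 1) \<noteq> 0"
    using p_mon_split[OF that(2)] that(1) by simp
  thus ?thesis using m
    by (auto simp: mat_of_def J_pos_single lookup_single when_def lookup_p_mon)
qed

text \<open>The Hall norm cancels the denominators in the exponential, so pairing with the source is
  evaluation at p_q = s_q.\<close>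

lemma emb_mz_src_coeff: "\<iota> (mz \<mu>) * src_coeff s \<mu> = mval s \<mu>"
proof -
  have "of_nat (mval id \<mu>) * mval (\<lambda>q. s q / of_nat q) \<mu> = mval s \<mu>"
    unfolding mval_def using of_nat_emb_eq_0_iff
    by (simp add: of_nat_prod del: of_nat_Suc flip: prod.distrib power_mult_distrib)
  moreover have "of_nat (mfact \<mu>) \<noteq> (0::'k)" using of_nat_emb_eq_0_iff by simp
  ultimately show ?thesis
    unfolding mz_def emb_of_nat by (simp add: src_coeff_def)
qed

text \<open>Seen from the vacuum, J_m reads off m times the coefficient of p_m, and this m cancels
  the norm \<open>mz (p_mon m)\<close> coming from the adjoint.\<close>

lemma fls_nth_correlator:
  assumes w: "cut_join_symbol w" and m: "m \<ge> 1"
  shows "fls_nth (correlator \<iota> w s m) (-1) =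
    (\<Sum>\<mu>\<in>{\<mu>. mdeg \<mu> \<le> m}. \<iota> (Dexp (leading_symbol w) (Poly_Mapping.single (p_mon m) 1) \<mu>) * mval s \<mu>)"
proof -
  let ?h = "leading_symbol w"
  let ?D = "Dexp ?h (Poly_Mapping.single (p_mon m) 1)"
  define E where "E \<nu> = fmat_mult (\<lambda>\<nu> \<mu>. fls_map \<iota> (fmat_exp (cut_join w) \<nu> \<mu>)) (fmat_exp_nil (source \<iota> s)) \<nu> 0" for \<nu>
  have "fls_const (\<iota> (mat_of (J (int m)) 0 \<kappa>)) * E \<kappa> = (if \<kappa> = p_mon m then fls_const (of_nat m) * E \<kappa> else 0)" for \<kappa>
    using m by (simp add: mat_of_J_pos emb_0 emb_of_nat)
  hence "correlator \<iota> w s m = fls_const (of_nat m) * E (p_mon m)"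
    unfolding correlator_def fmat_mult_def[of "\<lambda>\<nu> \<mu>. fls_const (\<iota> (mat_of (J (int m)) \<nu> \<mu>))"] E_def[symmetric] by simp
  moreover have "E (p_mon m) = (\<Sum>\<mu>\<in>{\<mu>. mdeg \<mu> \<le> m}.
      fls_map \<iota> (fmat_exp (cut_join w) (p_mon m) \<mu>) * fmat_exp_nil (source \<iota> s) \<mu> 0)"
    unfolding E_def fmat_mult_def
  proof (rule Sum_any.expand_superset[OF finite_mdeg_le], clarify, rule ccontr)
    fix \<mu> assume nz: "fls_map \<iota> (fmat_exp (cut_join w) (p_mon m) \<mu>) * fmat_exp_nil (source \<iota> s) \<mu> 0 \<noteq> 0"
      and "\<not> mdeg \<mu> \<le> m"
    hence "fmat_exp (cut_join w) (p_mon m) \<mu> = 0"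
      using m by (intro exp_cut_join_eq_0[OF w]) (simp add: mdeg_p_mon)
    hence "fls_map \<iota> (fmat_exp (cut_join w) (p_mon m) \<mu>) = 0"
      by (intro fls_eqI) (simp add: fls_nth_map emb_0)
    with nz show False by simp
  qed
  \<comment> \<open>The orders \<open>mlen \<mu> - 1\<close> of the exponential of W and
    \<open>- mlen \<mu>\<close> of the source add up to -1 for every \<mu>, so only parts of weight
    0 enter.\<close>
  moreover have "fls_lead (-1) (\<Sum>\<mu>\<in>{\<mu>. mdeg \<mu> \<le> m}. \<iota> (mz \<mu> / of_nat m * ?D \<mu>) * src_coeff s \<mu>)
     (\<Sum>\<mu>\<in>{\<mu>. mdeg \<mu> \<le> m}. fls_map \<iota> (fmat_exp (cut_join w) (p_mon m) \<mu>) * fmat_exp_nil (source \<iota> s) \<mu> 0)"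
  proof (rule fls_lead_sum)
    fix \<mu>
    have "fls_lead (int (mlen \<mu>) - 1) (\<iota> (mz \<mu> / of_nat m * ?D \<mu>)) (fls_map \<iota> (fmat_exp (cut_join w) (p_mon m) \<mu>))"
      using fls_lead_exp_cut_join[OF w, of \<mu> "p_mon m"] m
      by (simp add: fls_lead_def fls_nth_map emb_0 mz_p_mon)
    moreover have "fls_lead (- int (mlen \<mu>)) (src_coeff s \<mu>) (fmat_exp_nil (source \<iota> s) \<mu> 0)"
      by (simp add: exp_source fls_lead_def)
    ultimately show "fls_lead (-1) (\<iota> (mz \<mu> / of_nat m * ?D \<mu>) * src_coeff s \<mu>)
      (fls_map \<iota> (fmat_exp (cut_join w) (p_mon m) \<mu>) * fmat_exp_nil (source \<iota> s) \<mu> 0)"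
      by (auto dest: fls_lead_mult)
  qed
  ultimately have "fls_nth (correlator \<iota> w s m) (-1) =
      of_nat m * (\<Sum>\<mu>\<in>{\<mu>. mdeg \<mu> \<le> m}. \<iota> (mz \<mu> / of_nat m * ?D \<mu>) * src_coeff s \<mu>)"
    by (simp add: fls_lead_def)
  also have "\<dots> = (\<Sum>\<mu>\<in>{\<mu>. mdeg \<mu> \<le> m}. \<iota> (?D \<mu>) * (\<iota> (mz \<mu>) * src_coeff s \<mu>))"
    using m of_nat_emb_eq_0_iff[of m]
    by (simp add: sum_distrib_left emb_mult emb_divide emb_of_nat mult_ac)
  finally show ?thesis by (simp add: emb_mz_src_coeff)
qed

end

section \<open>Evaluation at time one\<close>

text \<open>A series in the flow parameter with coefficients in the Fock space is evaluated at parameter 1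
  and \<open>p\<^sub>q = s\<^sub>q\<close>. Absolute convergence makes this multiplicative.\<close>

definition msupp :: "fock fps \<Rightarrow> mon set" where
  "msupp F = (\<Union>n. Poly_Mapping.keys (fps_nth F n))"

text \<open>Finiteness of \<open>msupp F\<close> is uniform: one finite set of monomials serves all
  powers of the flow parameter.\<close>

definition admissible :: "fock fps \<Rightarrow> bool" where
  "admissible F \<longleftrightarrow> finite (msupp F) \<and> (\<forall>\<mu>. summable (\<lambda>n. norm (Poly_Mapping.lookup (fps_nth F n) \<mu>)))"

definition mono_series :: "mon \<Rightarrow> (nat \<Rightarrow> complex) \<Rightarrow> fock fps" where
  "mono_series \<mu> f = Abs_fps (\<lambda>n. Poly_Mapping.single \<mu> (f n))"

definition eval1 :: "(complex \<Rightarrow> 'k::field) \<Rightarrow> (nat \<Rightarrow> 'k) \<Rightarrow> fock fps \<Rightarrow> 'k" where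
  "eval1 \<iota> s F = (\<Sum>\<mu>\<in>msupp F. \<iota> (suminf (\<lambda>n. Poly_Mapping.lookup (fps_nth F n) \<mu>)) * mval s \<mu>)"

lemma admissibleI:
  assumes "finite M" "\<And>n. Poly_Mapping.keys (fps_nth F n) \<subseteq> M"
    "\<And>\<mu>. summable (\<lambda>n. norm (Poly_Mapping.lookup (fps_nth F n) \<mu>))"
  shows "admissible F"
proof -
  have "msupp F \<subseteq> M" using assms(2) by (auto simp: msupp_def)
  thus ?thesis using assms(1,3) finite_subset by (auto simp: admissible_def)
qed

lemma msupp_add: "msupp (F + G) \<subseteq> msupp F \<union> msupp G"
  using keys_add by (fastforce simp: msupp_def)

lemma admissible_0 [simp]: "admissible 0"
  by (simp add: admissible_def msupp_def)

lemma admissible_add: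
  assumes "admissible F" "admissible G" shows "admissible (F + G)"
proof (rule admissibleI[of "msupp F \<union> msupp G"])
  show "Poly_Mapping.keys (fps_nth (F + G) n) \<subseteq> msupp F \<union> msupp G" for n
    using msupp_add[of F G] by (auto simp: msupp_def)
  fix \<mu>
  have "summable (\<lambda>n. norm (Poly_Mapping.lookup (fps_nth F n) \<mu>) + norm (Poly_Mapping.lookup (fps_nth G n) \<mu>))"
    using assms by (intro summable_add) (auto simp: admissible_def)
  thus "summable (\<lambda>n. norm (Poly_Mapping.lookup (fps_nth (F + G) n) \<mu>))"
    by (rule summable_comparison_test'[where N = 0]) (simp add: lookup_add norm_triangle_ineq)
qed (use assms in \<open>auto simp: admissible_def\<close>)

lemma admissible_sum: "(\<And>x. x \<in> A \<Longrightarrow> admissible (F x)) \<Longrightarrow> admissible (sum F A)"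
  by (induction A rule: infinite_finite_induct) (auto intro: admissible_add)

lemma summable_norm_Cauchy_product:
  fixes f g :: "nat \<Rightarrow> complex"
  assumes "summable (\<lambda>n. norm (f n))" "summable (\<lambda>n. norm (g n))"
  shows "summable (\<lambda>n. norm (\<Sum>i\<le>n. f i * g (n - i)))"
proof -
  have "summable (\<lambda>n. \<Sum>i\<le>n. norm (f i) * norm (g (n - i)))"
    using assms by (intro summable_Cauchy_product) simp_all
  thus ?thesis
    by (rule summable_comparison_test'[where N = 0]) (simp add: norm_mult[symmetric] norm_sum)
qed

lemma lookup_mono_series: "Poly_Mapping.lookup (fps_nth (mono_series \<mu> f) n) \<nu> = (if \<nu> = \<mu> then f n else 0)"
  by (auto simp: mono_series_def lookup_single when_def)

lemma msupp_mono_series: "msupp (mono_series \<mu> f) \<subseteq> {\<mu>}"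
  by (auto simp: msupp_def mono_series_def split: if_splits)

lemma admissible_mono_series:
  assumes "summable (\<lambda>n. norm (f n))"
  shows "admissible (mono_series \<mu> f)"
proof (rule admissibleI[of "{\<mu>}"])
  show "Poly_Mapping.keys (fps_nth (mono_series \<mu> f) n) \<subseteq> {\<mu>}" for n
    using msupp_mono_series[of \<mu> f] by (auto simp: msupp_def)
  show "summable (\<lambda>n. norm (Poly_Mapping.lookup (fps_nth (mono_series \<mu> f) n) \<nu>))" for \<nu>
    using assms by (cases "\<nu> = \<mu>") (simp_all add: lookup_mono_series)
qed simp

lemma mono_series_mult:
  "mono_series \<mu> f * mono_series \<nu> g = mono_series (\<mu> + \<nu>) (\<lambda>n. \<Sum>i\<le>n. f i * g (n - i))"
  by (rule fps_ext) (simp add: fps_mult_nth mono_series_def mult_single single_sum atMost_atLeast0)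

lemma mono_series_expansion:
  assumes "finite M" "msupp F \<subseteq> M"
  shows "F = (\<Sum>\<mu>\<in>M. mono_series \<mu> (\<lambda>n. Poly_Mapping.lookup (fps_nth F n) \<mu>))"
proof (intro fps_ext poly_mapping_eqI)
  fix n \<nu>
  have "Poly_Mapping.lookup (fps_nth F n) \<nu> = 0" if "\<nu> \<notin> M"
    using assms(2) that by (force simp: msupp_def in_keys_iff)
  thus "Poly_Mapping.lookup (fps_nth F n) \<nu> = Poly_Mapping.lookup (fps_nth
      (\<Sum>\<mu>\<in>M. mono_series \<mu> (\<lambda>n. Poly_Mapping.lookup (fps_nth F n) \<mu>)) n) \<nu>"
    using assms(1) by (simp add: fps_sum_nth lookup_sum lookup_mono_series)
qed

lemma admissible_mult:
  assumes "admissible F" "admissible G" shows "admissible (F * G)"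
proof -
  let ?c = "\<lambda>F \<mu>. mono_series \<mu> (\<lambda>n. Poly_Mapping.lookup (fps_nth F n) \<mu>)"
  have "F * G = (\<Sum>\<mu>\<in>msupp F. ?c F \<mu>) * (\<Sum>\<nu>\<in>msupp G. ?c G \<nu>)"
    using assms mono_series_expansion[of "msupp F" F] mono_series_expansion[of "msupp G" G]
    by (simp add: admissible_def)
  also have "admissible \<dots>"
    unfolding sum_product mono_series_mult using assms
    by (intro admissible_sum admissible_mono_series summable_norm_Cauchy_product) (auto simp: admissible_def)
  finally show ?thesis .
qed

context
  fixes \<iota> :: "complex \<Rightarrow> 'k::field" and s :: "nat \<Rightarrow> 'k"
  assumes \<iota>: "field_embedding \<iota>"
begin

lemma eval1_superset:
  assumes "finite M" "msupp F \<subseteq> M"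
  shows "eval1 \<iota> s F = (\<Sum>\<mu>\<in>M. \<iota> (suminf (\<lambda>n. Poly_Mapping.lookup (fps_nth F n) \<mu>)) * mval s \<mu>)"
proof -
  have "Poly_Mapping.lookup (fps_nth F n) \<mu> = 0" if "\<mu> \<notin> msupp F" for n \<mu>
    using that by (auto simp: msupp_def in_keys_iff)
  thus ?thesis unfolding eval1_def using assms
    by (intro sum.mono_neutral_left) (auto simp: emb_0[OF \<iota>])
qed

lemma eval1_0 [simp]: "eval1 \<iota> s 0 = 0"
  by (simp add: eval1_def msupp_def)

lemma eval1_add:
  assumes "admissible F" "admissible G"
  shows "eval1 \<iota> s (F + G) = eval1 \<iota> s F + eval1 \<iota> s G"
proof -
  let ?M = "msupp F \<union> msupp G"
  have fin: "finite ?M" using assms by (simp add: admissible_def)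
  have "summable (\<lambda>n. Poly_Mapping.lookup (fps_nth F n) \<mu>)" "summable (\<lambda>n. Poly_Mapping.lookup (fps_nth G n) \<mu>)" for \<mu>
    using assms by (auto simp: admissible_def intro: summable_norm_cancel)
  hence "suminf (\<lambda>n. Poly_Mapping.lookup (fps_nth (F + G) n) \<mu>) =
      suminf (\<lambda>n. Poly_Mapping.lookup (fps_nth F n) \<mu>) + suminf (\<lambda>n. Poly_Mapping.lookup (fps_nth G n) \<mu>)" for \<mu>
    by (simp add: lookup_add suminf_add)
  thus ?thesis
    using eval1_superset[OF fin, of F] eval1_superset[OF fin, of G] eval1_superset[OF fin msupp_add]
    by (simp add: emb_add[OF \<iota>] algebra_simps sum.distrib)
qed

lemma eval1_sum: "(\<And>x. x \<in> A \<Longrightarrow> admissible (F x)) \<Longrightarrow> eval1 \<iota> s (sum F A) = (\<Sum>x\<in>A. eval1 \<iota> s (F x))"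
  by (induction A rule: infinite_finite_induct) (auto simp: eval1_add admissible_sum)

lemma eval1_mono_series: "eval1 \<iota> s (mono_series \<mu> f) = \<iota> (suminf f) * mval s \<mu>"
  by (subst eval1_superset[OF _ msupp_mono_series]) (simp_all add: lookup_mono_series)

text \<open>Both factors split into finitely many pieces \<open>mono_series\<close>; for a pair of
  these the claim is the Cauchy product of absolutely convergent series.\<close>

lemma eval1_mult:
  assumes "admissible F" "admissible G"
  shows "eval1 \<iota> s (F * G) = eval1 \<iota> s F * eval1 \<iota> s G"
proof -
  let ?l = "\<lambda>F \<mu> n. Poly_Mapping.lookup (fps_nth F n) \<mu>"
  let ?c = "\<lambda>F \<mu>. mono_series \<mu> (?l F \<mu>)"
  have sF: "summable (\<lambda>n. norm (?l F \<mu> n))" and sG: "summable (\<lambda>n. norm (?l G \<mu> n))" for \<mu>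
    using assms by (auto simp: admissible_def)
  have adm: "admissible (?c F \<mu> * ?c G \<nu>)" for \<mu> \<nu>
    by (intro admissible_mult admissible_mono_series sF sG)
  have "F * G = (\<Sum>\<mu>\<in>msupp F. ?c F \<mu>) * (\<Sum>\<nu>\<in>msupp G. ?c G \<nu>)"
    using assms mono_series_expansion[of "msupp F" F] mono_series_expansion[of "msupp G" G]
    by (simp add: admissible_def)
  hence "eval1 \<iota> s (F * G) = (\<Sum>\<mu>\<in>msupp F. \<Sum>\<nu>\<in>msupp G. eval1 \<iota> s (?c F \<mu> * ?c G \<nu>))"
    by (simp only: sum_product) (simp add: eval1_sum admissible_sum adm)
  also have "\<dots> = (\<Sum>\<mu>\<in>msupp F. \<Sum>\<nu>\<in>msupp G.
      (\<iota> (suminf (?l F \<mu>)) * mval s \<mu>) * (\<iota> (suminf (?l G \<nu>)) * mval s \<nu>))"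
    by (intro sum.cong refl) (simp add: mono_series_mult eval1_mono_series mval_add emb_mult[OF \<iota>] mult_ac
        flip: Cauchy_product[OF sF sG])
  finally show ?thesis by (simp add: eval1_def sum_product)
qed

end

text \<open>In \<open>fock fps fps\<close> the flow parameter is the outer variable and \<open>z\<close> the inner one.\<close>

definition slice :: "fock fps fps \<Rightarrow> nat \<Rightarrow> fock fps" where
  "slice F a = Abs_fps (\<lambda>n. fps_nth (fps_nth F n) a)"

definition admissible_z :: "fock fps fps \<Rightarrow> bool" where
  "admissible_z F \<longleftrightarrow> (\<forall>a. admissible (slice F a))"

definition eval_z :: "(complex \<Rightarrow> 'k::field) \<Rightarrow> (nat \<Rightarrow> 'k) \<Rightarrow> fock fps fps \<Rightarrow> 'k fps" where
  "eval_z \<iota> s F = Abs_fps (\<lambda>a. eval1 \<iota> s (slice F a))"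

lemma slice_mult: "slice (F * G) a = (\<Sum>i\<le>a. slice F i * slice G (a - i))"
  by (rule fps_ext)
     (simp add: slice_def fps_mult_nth fps_sum_nth atMost_atLeast0 sum.swap[of _ "{0..a}"])

lemma admissible_z_mult: "admissible_z F \<Longrightarrow> admissible_z G \<Longrightarrow> admissible_z (F * G)"
  unfolding admissible_z_def slice_mult by (intro allI admissible_sum admissible_mult) auto

lemma eval_z_mult:
  "field_embedding \<iota> \<Longrightarrow> admissible_z F \<Longrightarrow> admissible_z G \<Longrightarrow> eval_z \<iota> s (F * G) = eval_z \<iota> s F * eval_z \<iota> s G"
  by (rule fps_ext)
     (simp add: eval_z_def slice_mult fps_mult_nth eval1_sum eval1_mult admissible_mult admissible_z_def atMost_atLeast0)

lemma slice_1: "slice 1 a = (if a = 0 then mono_series 0 (\<lambda>n. if n = 0 then 1 else 0) else 0)"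
  by (rule fps_ext) (auto simp: slice_def mono_series_def)

lemma admissible_z_1: "admissible_z 1"
proof -
  have "summable (\<lambda>n. norm (if n = 0 then 1 else 0 :: complex))"
    by (rule summable_finite[of "{0}"]) auto
  thus ?thesis unfolding admissible_z_def slice_1 by (auto intro!: admissible_mono_series)
qed

lemma eval_z_1: "field_embedding \<iota> \<Longrightarrow> eval_z \<iota> s 1 = 1"
proof (rule fps_ext)
  fix n assume "field_embedding \<iota>"
  moreover have "suminf (\<lambda>n. if n = 0 then 1 else 0 :: complex) = 1"
    using suminf_finite[of "{0}" "\<lambda>n. if n = 0 then 1 else 0 :: complex"] by simp
  ultimately show "fps_nth (eval_z \<iota> s 1) n = fps_nth 1 n"
    by (simp add: eval_z_def slice_1 eval1_mono_series emb_1 eval1_0)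
qed

lemma admissible_z_power: "admissible_z F \<Longrightarrow> admissible_z (F ^ m)"
  by (induction m) (auto simp: admissible_z_1 admissible_z_mult)

lemma eval_z_power: "field_embedding \<iota> \<Longrightarrow> admissible_z F \<Longrightarrow> eval_z \<iota> s (F ^ m) = eval_z \<iota> s F ^ m"
  by (induction m) (auto simp: eval_z_1 eval_z_mult admissible_z_power)

section \<open>The exponential of a derivation\<close>

definition cfact :: "nat \<Rightarrow> fock fps" where
  "cfact n = fps_const (Poly_Mapping.single 0 (1 / fact n))"

lemma cfact_mult: "i \<le> n \<Longrightarrow> cfact i * cfact (n - i) = cfact n * of_nat (n choose i)"
proof -
  assume "i \<le> n"
  hence *: "(1 / fact i) * (1 / fact (n - i)) = (1 / fact n) * (of_nat (n choose i) :: complex)"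
    by (simp add: binomial_fact field_simps)
  have "(of_nat (n choose i) :: fock fps) = fps_const (Poly_Mapping.single 0 (of_nat (n choose i)))"
    by (simp add: fps_of_nat)
  thus ?thesis unfolding cfact_def by (simp only: fps_const_mult mult_single * add_0_right)
qed

definition dexp :: "(fock fps \<Rightarrow> fock fps) \<Rightarrow> fock fps \<Rightarrow> fock fps fps" where
  "dexp \<delta> x = Abs_fps (\<lambda>n. cfact n * (\<delta> ^^ n) x)"

lemma derivation_iter_mult:
  assumes "derivation \<delta>"
  shows "(\<delta> ^^ n) (x * y) = (\<Sum>i\<le>n. of_nat (n choose i) * (\<delta> ^^ i) x * (\<delta> ^^ (n - i)) y)"
proof (induction n)
  case (Suc n)
  have \<delta>n: "\<delta> (of_nat k) = 0" for k
    using derivation_0[OF assms] derivation_1[OF assms] by (induction k) (auto simp: derivation_add[OF assms])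
  let ?t = "\<lambda>i j. (\<delta> ^^ i) x * (\<delta> ^^ j) y"
  have "(\<delta> ^^ Suc n) (x * y) = (\<Sum>i\<le>n. of_nat (n choose i) * ?t (Suc i) (n - i)) +
      (\<Sum>i\<le>n. of_nat (n choose i) * ?t i (Suc n - i))"
    by (simp add: Suc derivation_sum[OF assms] derivation_mult[OF assms] \<delta>n sum.distrib algebra_simps Suc_diff_le)
  \<comment> \<open>The added term \<open>i = Suc n\<close> has binomial coefficient 0. With it in
    place the index can be shifted and Pascal's rule applied.\<close>
  also have "(\<Sum>i\<le>n. of_nat (n choose i) * ?t i (Suc n - i)) =
      (\<Sum>i\<le>Suc n. of_nat (n choose i) * ?t i (Suc n - i))"
    by (simp add: binomial_eq_0)
  also have "\<dots> = ?t 0 (Suc n) + (\<Sum>i\<le>n. of_nat (n choose Suc i) * ?t (Suc i) (n - i))"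
    by (subst sum.atMost_Suc_shift) simp
  also have "(\<Sum>i\<le>n. of_nat (n choose i) * ?t (Suc i) (n - i)) +
      (?t 0 (Suc n) + (\<Sum>i\<le>n. of_nat (n choose Suc i) * ?t (Suc i) (n - i))) =
      ?t 0 (Suc n) + (\<Sum>i\<le>n. of_nat (Suc n choose Suc i) * ?t (Suc i) (n - i))"
    by (simp add: sum.distrib algebra_simps)
  also have "\<dots> = (\<Sum>i\<le>Suc n. of_nat (Suc n choose i) * ?t i (Suc n - i))"
    by (subst sum.atMost_Suc_shift) simp
  finally show ?case by (simp only: mult.assoc)
qed simp

text \<open>After division by n! the binomial coefficients of the iterated Leibniz rule become 1/(i!
  (n-i)!), and the sum is a Cauchy product.\<close>

lemma dexp_mult:
  assumes "derivation \<delta>"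
  shows "dexp \<delta> (x * y) = dexp \<delta> x * dexp \<delta> y"
proof (rule fps_ext)
  fix n
  have "cfact n * (of_nat (n choose i) * (\<delta> ^^ i) x * (\<delta> ^^ (n - i)) y) =
      (cfact i * (\<delta> ^^ i) x) * (cfact (n - i) * (\<delta> ^^ (n - i)) y)" if "i \<le> n" for i
  proof -
    have "cfact n * (of_nat (n choose i) * (\<delta> ^^ i) x * (\<delta> ^^ (n - i)) y) =
       (cfact n * of_nat (n choose i)) * ((\<delta> ^^ i) x * (\<delta> ^^ (n - i)) y)" by (simp only: mult_ac)
    also have "\<dots> = (cfact i * (\<delta> ^^ i) x) * (cfact (n - i) * (\<delta> ^^ (n - i)) y)"
      unfolding cfact_mult[OF that, symmetric] by (simp only: mult_ac)
    finally show ?thesis .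
  qed
  hence "(\<Sum>i\<le>n. cfact n * (of_nat (n choose i) * (\<delta> ^^ i) x * (\<delta> ^^ (n - i)) y)) =
      (\<Sum>i\<le>n. (cfact i * (\<delta> ^^ i) x) * (cfact (n - i) * (\<delta> ^^ (n - i)) y))"
    by (intro sum.cong) auto
  thus "fps_nth (dexp \<delta> (x * y)) n = fps_nth (dexp \<delta> x * dexp \<delta> y) n"
    by (simp add: dexp_def derivation_iter_mult[OF assms] fps_mult_nth sum_distrib_left atMost_atLeast0)
qed

lemma dexp_1: "derivation \<delta> \<Longrightarrow> dexp \<delta> 1 = 1"
proof (rule fps_ext)
  fix n assume d: "derivation \<delta>"
  have "(\<delta> ^^ Suc k) 1 = 0" for k
    by (induction k) (simp_all add: derivation_1[OF d] derivation_0[OF d])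
  thus "fps_nth (dexp \<delta> 1) n = fps_nth 1 n"
    by (cases n) (simp_all add: dexp_def cfact_def)
qed

lemma dexp_power: "derivation \<delta> \<Longrightarrow> dexp \<delta> (x ^ m) = dexp \<delta> x ^ m"
  by (induction m) (auto simp: dexp_1 dexp_mult)

section \<open>The flow in the coordinates \<open>(z, P(z))\<close>\<close>

definition Dz :: "series_zs \<Rightarrow> fock fps \<Rightarrow> fock fps" where
  "Dz h F = Abs_fps (\<lambda>a. Dop h (fps_nth F a))"

definition Dflow :: "series_zs \<Rightarrow> fock fps \<Rightarrow> fock fps" where
  "Dflow h F = Dz h F - Ksub (d_s h) * fps_XD F"

lemma derivation_Dz: "derivation (Dz h)"
  unfolding derivation_def
  by (auto intro!: fps_ext simp: Dz_def fps_mult_nth derivation_add[OF derivation_Dop]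
      derivation_mult[OF derivation_Dop] derivation_sum[OF derivation_Dop] sum.distrib)

lemma derivation_XD: "derivation (fps_XD :: fock fps \<Rightarrow> fock fps)"
  unfolding derivation_def by (simp add: fps_XD_def algebra_simps)

lemma derivation_Dflow: "derivation (Dflow h)"
  unfolding derivation_def Dflow_def
  by (simp add: derivation_add[OF derivation_Dz] derivation_mult[OF derivation_Dz]
      derivation_add[OF derivation_XD] derivation_mult[OF derivation_XD] algebra_simps)

lemma XD_nth: "fps_nth (fps_XD F) n = of_nat n * fps_nth F n" for F :: "'a::comm_ring_1 fps"
  by (cases n) (simp_all add: fps_XD_def)

lemma of_nat_mult_single: "of_nat n * Poly_Mapping.single 0 c = (Poly_Mapping.single 0 (of_nat n * c) :: fock)"
  by (simp add: mult_single flip: single_of_nat)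

lemma XD_Ksub: "fps_XD (Ksub f) = Ksub (zd_z f) + Ksub (d_s f) * fps_XD Pser"
proof -
  have "fps_XD (lift_fock g) = lift_fock (fps_XD g)" for g
    by (rule fps_ext) (simp add: XD_nth of_nat_mult_single)
  from derivation_Ksub[OF derivation_XD this, of f] show ?thesis
    by (simp add: zd_z_def d_s_def XD_nth)
qed

text \<open>The factor m in D p_m is the one that z d/dz puts in front of z^m.\<close>

lemma Dz_Pser: "Dz h Pser = fps_XD (Ksub h)"
  by (rule fps_ext) (simp add: Dz_def Pser_nth XD_nth Csym_def Dop_p_mon derivation_0[OF derivation_Dop])

lemma Dz_Ksub: "Dz h (Ksub f) = Ksub (d_s f) * fps_XD (Ksub h)"
proof -
  have "Dz h (lift_fock g) = lift_fock 0" for g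
    by (rule fps_ext) (simp add: Dz_def Dop_const)
  moreover have Abs_0: "Abs_fps (\<lambda>b. 0) = (0 :: series_zs)"
    by (simp add: fps_eq_iff)
  moreover have Ksub_0: "Ksub 0 = 0"
    by (simp add: Ksub_def fps_eq_iff)
  moreover have "fps_nth (Dz h F) n = 0" if "\<And>i. i \<le> n \<Longrightarrow> fps_nth F i = 0" for F n
    using that[of n] by (simp add: Dz_def derivation_0[OF derivation_Dop])
  ultimately show ?thesis
    using derivation_Ksub[OF derivation_Dz, of h "\<lambda>_. 0" f]
    by (simp add: d_s_def Dz_Pser Abs_0 Ksub_0)
qed

text \<open>By the two chain rules both parts of \<open>Dflow\<close> contain the product of the
  s-derivatives of \<open>h\<close> and \<open>f\<close> with z dP/dz. These terms cancel, and the
  Poisson bracket at s = P(z) remains.\<close>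

lemma Dflow_Ksub: "Dflow h (Ksub f) = Ksub (ham_field h f)"
  unfolding Dflow_def Dz_Ksub ham_field_def Ksub_diff Ksub_mult XD_Ksub by (simp add: algebra_simps)

lemma Dflow_iter_Ksub: "(Dflow h ^^ n) (Ksub f) = Ksub ((ham_field h ^^ n) f)"
  by (induction n) (auto simp: Dflow_Ksub)

text \<open>The correction term contains z d/dz, which kills series constant in z; there D' is just
  D.\<close>

lemma Dflow_const: "Dflow h (fps_const f) = fps_const (Dop h f)"
  by (rule fps_ext) (auto simp: Dflow_def Dz_def fps_XD_def derivation_0[OF derivation_Dop])

lemma Dflow_iter_const: "(Dflow h ^^ n) (fps_const f) = fps_const ((Dop h ^^ n) f)"
  by (induction n) (auto simp: Dflow_const)

lemma Dflow_iter_vanish: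
  "(\<And>i. i \<le> a \<Longrightarrow> fps_nth F i = 0) \<Longrightarrow> i \<le> a \<Longrightarrow> fps_nth ((Dflow h ^^ n) F) i = 0"
proof (induction n arbitrary: i)
  case (Suc n)
  thus ?case
    by (auto simp: Dflow_def Dz_def derivation_0[OF derivation_Dop] fps_mult_nth XD_nth intro!: sum.neutral)
qed simp

text \<open>D' never lowers the order in z, so at order \<open>a\<close> the series P may be
  replaced by a finite sum of products of p_m and z^m, to which multiplicativity of the exponential
  applies.\<close>

lemma Dflow_iter_Pser:
  "fps_nth ((Dflow h ^^ n) Pser) a =
    (\<Sum>m\<in>{1..a}. fps_nth ((Dflow h ^^ n) (fps_const (Poly_Mapping.single (p_mon m) 1) * fps_X ^ m)) a)"
proof -
  have diff: "(Dflow h ^^ n) (F - G) = (Dflow h ^^ n) F - (Dflow h ^^ n) G" for F G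
    by (induction n) (auto simp: derivation_diff[OF derivation_Dflow])
  have sum: "(Dflow h ^^ n) (sum g A) = (\<Sum>x\<in>A. (Dflow h ^^ n) (g x))" for g and A :: "nat set"
    by (induction n) (auto simp: derivation_sum[OF derivation_Dflow])
  let ?F = "Pser - (\<Sum>m\<in>{1..a}. fps_const (Poly_Mapping.single (p_mon m) 1) * fps_X ^ m)"
  have "fps_nth ?F i = 0" if "i \<le> a" for i
    using that by (auto simp: Pser_nth fps_sum_nth if_distrib cong: if_cong)
  hence "fps_nth ((Dflow h ^^ n) ?F) a = 0" by (rule Dflow_iter_vanish) auto
  thus ?thesis by (simp add: diff sum fps_sum_nth)
qed

text \<open>Divisibility of \<open>h\<close> by \<open>s\<close> makes the vector field triangular in the degrees of both variables, which is
  why its exponential converges coefficientwise.\<close>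

lemma ham_field_nth:
  assumes "fps_nth h 0 = 0"
  shows "fps_nth (fps_nth (ham_field h f) b) a = (\<Sum>(b', a')\<in>{..b} \<times> {..a}.
    (of_nat b' * fps_nth (fps_nth (zd_z h) (Suc b - b')) (a - a')
      - of_nat a' * fps_nth (fps_nth (d_s h) (b - b')) (a - a')) * fps_nth (fps_nth f b') a')"
proof -
  let ?g = "\<lambda>b'. (of_nat b' * fps_nth f b') * fps_nth (zd_z h) (Suc b - b')"
  have "fps_nth (zd_z h * d_s f) b = (\<Sum>i\<le>b. fps_nth (d_s f) i * fps_nth (zd_z h) (b - i))"
    by (subst mult.commute) (simp add: fps_mult_nth atMost_atLeast0)
  \<comment> \<open>The term \<open>i = b\<close> would bring in the coefficient of \<open>f\<close>
    at order \<open>b + 1\<close> in s. It is multiplied by the coefficient of \<open>zd_z h\<close>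
    at order 0, which vanishes because \<open>h\<close> is divisible by s.\<close>
  also have "\<dots> = (\<Sum>i<b. ?g (Suc i))"
    using assms by (simp add: lessThan_Suc_atMost[symmetric] zd_z_def d_s_def fps_XD_def)
  also have "\<dots> = (\<Sum>b'<Suc b. ?g b')"
    by (subst sum.lessThan_Suc_shift) simp
  finally have "fps_nth (fps_nth (zd_z h * d_s f) b) a =
      (\<Sum>b'\<le>b. \<Sum>a'\<le>a. of_nat b' * fps_nth (fps_nth f b') a' * fps_nth (fps_nth (zd_z h) (Suc b - b')) (a - a'))"
    by (simp add: lessThan_Suc_atMost fps_sum_nth fps_mult_nth[of "of_nat _ * _"] fps_mult_of_nat_nth
        atMost_atLeast0)
  moreover have "fps_nth (fps_nth (d_s h * zd_z f) b) a =
      (\<Sum>b'\<le>b. \<Sum>a'\<le>a. of_nat a' * fps_nth (fps_nth f b') a' * fps_nth (fps_nth (d_s h) (b - b')) (a - a'))"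
    by (subst mult.commute) (simp add: fps_mult_nth fps_sum_nth zd_z_def XD_nth atMost_atLeast0)
  ultimately show ?thesis
    by (simp add: ham_field_def sum.cartesian_product[symmetric] sum_subtractf algebra_simps)
qed

lemma summable_ham_field_iter:
  assumes "fps_nth h 0 = 0"
  shows "summable (\<lambda>n. norm (fps_nth (fps_nth ((ham_field h ^^ n) f) b) a / fact n))"
proof -
  let ?u = "\<lambda>n (b, a). fps_nth (fps_nth ((ham_field h ^^ n) f) b) a"
  let ?M = "\<lambda>(b, a) (b', a'). of_nat b' * fps_nth (fps_nth (zd_z h) (Suc b - b')) (a - a')
      - of_nat a' * fps_nth (fps_nth (d_s h) (b - b')) (a - a')"
  \<comment> \<open>Padding by zeros puts all rows of the triangular recursion on one fixed
    rectangle, as \<open>summable_iterates\<close> requires.\<close>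
  let ?N = "\<lambda>x y. if fst y \<le> fst x \<and> snd y \<le> snd x then ?M x y else 0"
  have "?u (Suc n) x = (\<Sum>y\<in>{..b} \<times> {..a}. ?N x y * ?u n y)" if "x \<in> {..b} \<times> {..a}" for n x
  proof -
    obtain b1 a1 where x0: "x = (b1, a1)" by (cases x)
    hence x: "x = (b1, a1)" "b1 \<le> b" "a1 \<le> a" using that by auto
    have "?u (Suc n) x = (\<Sum>y\<in>{..b1} \<times> {..a1}. ?M x y * ?u n y)"
      by (simp add: x(1) ham_field_nth[OF assms] case_prod_beta)
    also have "\<dots> = (\<Sum>y\<in>{..b} \<times> {..a}. ?N x y * ?u n y)"
      by (rule sum.mono_neutral_cong_left) (use x in auto)
    finally show ?thesis .
  qed
  from summable_iterates[where f = ?u and x = "(b, a)", OF _ this] show ?thesis by simp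
qed

section \<open>The exponentiated flow evaluated at p_q = s_q\<close>

lemma S_series_power_nth:
  "fps_nth (S_series s ^ r) n = (\<Sum>ls\<in>plists n r. mval s (sum_list (map p_mon ls)))"
proof (induction r arbitrary: n)
  case (Suc r)
  have S_nth: "fps_nth (S_series s) i = (if i = 0 then 0 else s i)" for i
    by (simp add: S_series_def)
  have "fps_nth (S_series s ^ Suc r) n = (\<Sum>i\<in>{0..n}. fps_nth (S_series s) i * fps_nth (S_series s ^ r) (n - i))"
    by (simp add: fps_mult_nth)
  also have "\<dots> = (\<Sum>i\<in>{1..n}. fps_nth (S_series s) i * fps_nth (S_series s ^ r) (n - i))"
    by (rule sum.mono_neutral_right) (auto simp: S_nth)
  also have "\<dots> = (\<Sum>i\<in>{1..n}. \<Sum>ls\<in>(#) i ` plists (n - i) r. mval s (sum_list (map p_mon ls)))"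
    by (intro sum.cong refl) (simp add: S_nth Suc sum.reindex sum_distrib_left mval_add mval_p_mon)
  also have "\<dots> = (\<Sum>ls\<in>plists n (Suc r). mval s (sum_list (map p_mon ls)))"
    unfolding plists_Suc by (intro sum.UNION_disjoint[symmetric]) auto
  finally show ?case .
qed (simp add: plists_0)

text \<open>Because D' corresponds to the Hamiltonian field under \<open>Ksub\<close>, the flow
  parameter enters only through scalar series attached to fixed monomials.\<close>

lemma slice_dexp_Ksub:
  "slice (dexp (Dflow h) (Ksub f)) a = (\<Sum>b\<le>a. \<Sum>i\<le>a. \<Sum>ls\<in>plists (a - i) b.
     mono_series (sum_list (map p_mon ls)) (\<lambda>n. fps_nth (fps_nth ((ham_field h ^^ n) f) b) i / fact n))"
proof (rule fps_ext)
  fix n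
  have "fps_nth (slice (dexp (Dflow h) (Ksub f)) a) n =
      Poly_Mapping.single 0 (1 / fact n) * fps_nth (Ksub ((ham_field h ^^ n) f)) a"
    by (simp add: slice_def dexp_def cfact_def Dflow_iter_Ksub)
  thus "fps_nth (slice (dexp (Dflow h) (Ksub f)) a) n = fps_nth (\<Sum>b\<le>a. \<Sum>i\<le>a. \<Sum>ls\<in>plists (a - i) b.
     mono_series (sum_list (map p_mon ls)) (\<lambda>n. fps_nth (fps_nth ((ham_field h ^^ n) f) b) i / fact n)) n"
    by (simp add: Ksub_def fps_mult_nth fps_sum_nth mono_series_def Pser_power_nth sum_distrib_left mult_single
        atMost_atLeast0)
qed

lemma fps_nth_time1_flow:
  "fps_nth (fps_nth (time1 (flow h f)) b) i = suminf (\<lambda>n. fps_nth (fps_nth ((ham_field h ^^ n) f) b) i / fact n)"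
  by (simp add: time1_def flow_def)

lemma admissible_dexp_Ksub:
  "fps_nth h 0 = 0 \<Longrightarrow> admissible_z (dexp (Dflow h) (Ksub f))"
  unfolding admissible_z_def slice_dexp_Ksub
  by (intro allI admissible_sum admissible_mono_series summable_ham_field_iter)

text \<open>Setting p_q = s_q turns P(z) into S(z), while the scalar series in the flow parameter
  sum to the coefficients of the time-one flow.\<close>

lemma eval_dexp_Ksub:
  assumes \<iota>: "field_embedding \<iota>" and h: "fps_nth h 0 = 0"
  shows "eval_z \<iota> s (dexp (Dflow h) (Ksub f)) = subst_s \<iota> (time1 (flow h f)) (S_series s)"
proof (rule fps_ext)
  fix a
  show "fps_nth (eval_z \<iota> s (dexp (Dflow h) (Ksub f))) a =
      fps_nth (subst_s \<iota> (time1 (flow h f)) (S_series s)) a"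
    by (simp add: eval_z_def slice_dexp_Ksub eval1_sum[OF \<iota>] admissible_sum admissible_mono_series
        summable_ham_field_iter[OF h] eval1_mono_series[OF \<iota>] subst_s_def fps_mult_nth fps_map_def
        fps_nth_time1_flow S_series_power_nth sum_distrib_left atMost_atLeast0)
qed

lemma slice_dexp_const:
  "slice (dexp (Dflow h) (fps_const f)) a =
    (if a = 0 then Abs_fps (\<lambda>n. Poly_Mapping.single 0 (1 / fact n) * (Dop h ^^ n) f) else 0)"
  by (rule fps_ext) (auto simp: slice_def dexp_def cfact_def Dflow_iter_const)

text \<open>On series constant in z only D acts, and its iterates stay within degree d; this gives
  the uniform finite support.\<close>

lemma
  assumes f: "\<And>\<mu>. \<mu> \<in> Poly_Mapping.keys f \<Longrightarrow> mdeg \<mu> \<le> d"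
  shows admissible_dexp_const: "admissible_z (dexp (Dflow h) (fps_const f))"
    and eval_dexp_const: "field_embedding \<iota> \<Longrightarrow> eval_z \<iota> s (dexp (Dflow h) (fps_const f)) =
      fps_const (\<Sum>\<mu>\<in>{\<mu>. mdeg \<mu> \<le> d}. \<iota> (Dexp h f \<mu>) * mval s \<mu>)"
proof -
  define E where "E = Abs_fps (\<lambda>n. Poly_Mapping.single 0 (1 / fact n) * (Dop h ^^ n) f)"
  have l: "Poly_Mapping.lookup (fps_nth E n) \<mu> = Poly_Mapping.lookup ((Dop h ^^ n) f) \<mu> / fact n" for n \<mu>
    by (simp add: E_def lookup_single_0_mult)
  have k: "Poly_Mapping.keys (fps_nth E n) \<subseteq> {\<mu>. mdeg \<mu> \<le> d}" for n
    using keys_Dop_iter[of f d _ n h] f by (auto simp: in_keys_iff l)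
  have "admissible E"
    using summable_Dop_iter[where f = f and h = h] by (intro admissibleI[OF finite_mdeg_le k]) (simp add: l)
  thus "admissible_z (dexp (Dflow h) (fps_const f))"
    by (auto simp: admissible_z_def slice_dexp_const E_def)
  assume \<iota>: "field_embedding \<iota>"
  have "msupp E \<subseteq> {\<mu>. mdeg \<mu> \<le> d}" using k by (auto simp: msupp_def)
  from eval1_superset[OF \<iota> finite_mdeg_le this]
  have "eval1 \<iota> s E = (\<Sum>\<mu>\<in>{\<mu>. mdeg \<mu> \<le> d}. \<iota> (Dexp h f \<mu>) * mval s \<mu>)"
    by (simp add: l Dexp_def)
  thus "eval_z \<iota> s (dexp (Dflow h) (fps_const f)) =
      fps_const (\<Sum>\<mu>\<in>{\<mu>. mdeg \<mu> \<le> d}. \<iota> (Dexp h f \<mu>) * mval s \<mu>)"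
    by (intro fps_ext) (simp add: eval_z_def slice_dexp_const eval1_0[OF \<iota>] flip: E_def)
qed

lemma Ksub_var_z: "Ksub var_z = fps_X"
proof (rule fps_ext)
  fix n
  have "fps_nth (Ksub var_z) n = (\<Sum>b\<le>n. if b = 0 then fps_nth (lift_fock fps_X) n else 0)"
    unfolding Ksub_def fps_nth_Abs_fps by (intro sum.cong) (auto simp: var_z_def)
  thus "fps_nth (Ksub var_z) n = fps_nth fps_X n" by simp
qed

lemma Ksub_var_s: "Ksub var_s = Pser"
proof (rule fps_ext)
  fix n
  have "lift_fock 1 = 1" by (rule fps_ext) simp
  hence "fps_nth (Ksub var_s) n = (\<Sum>b\<le>n. if b = 1 then fps_nth Pser n else 0)"
    unfolding Ksub_def fps_nth_Abs_fps by (intro sum.cong) (auto simp: var_s_def)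
  thus "fps_nth (Ksub var_s) n = fps_nth Pser n" by (simp add: Pser_nth)
qed

text \<open>Both sides are exp(D') P evaluated at p_q = s_q: the right one through
  \<open>Ksub_var_s\<close>, the left one through the expansion of P into the p_m z^m and the
  multiplicativity of exp(D').\<close>

lemma omega01_compose:
  assumes \<iota>: "field_embedding \<iota>" and w: "cut_join_symbol w" and h: "fps_nth (leading_symbol w) 0 = 0"
  shows "omega01 \<iota> w s oo X_curve \<iota> (leading_symbol w) s =
    subst_s \<iota> (time1 (Upsilon (leading_symbol w))) (S_series s)"
proof (rule fps_ext)
  fix a
  define h where "h = leading_symbol w"
  have h0: "fps_nth h 0 = 0" using assms by (simp add: h_def)
  define E where "E = dexp (Dflow h)"
  define p :: "nat \<Rightarrow> fock" where "p m = Poly_Mapping.single (p_mon m) 1" for m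
  have admX: "admissible_z (E fps_X)"
    using admissible_dexp_Ksub[OF h0, of var_z] by (simp add: E_def Ksub_var_z)
  have evX: "eval_z \<iota> s (E fps_X) = X_curve \<iota> h s"
    using eval_dexp_Ksub[OF \<iota> h0, of s var_z] by (simp add: E_def Ksub_var_z X_curve_def Xi_def)
  have key: "mdeg \<mu> \<le> m" if "m \<ge> 1" "\<mu> \<in> Poly_Mapping.keys (p m)" for m \<mu>
    using that by (simp add: p_def mdeg_p_mon)
  have admp: "admissible_z (E (fps_const (p m)))" if "m \<ge> 1" for m
    unfolding E_def by (rule admissible_dexp_const[OF key[OF that]])
  have evp: "eval_z \<iota> s (E (fps_const (p m))) = fps_const (fps_nth (omega01 \<iota> w s) m)" if "m \<ge> 1" for m
  proof -
    have "eval_z \<iota> s (E (fps_const (p m))) =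
        fps_const (\<Sum>\<mu>\<in>{\<mu>. mdeg \<mu> \<le> m}. \<iota> (Dexp h (p m) \<mu>) * mval s \<mu>)"
      unfolding E_def by (rule eval_dexp_const[OF _ \<iota>]) (rule key[OF that])
    thus ?thesis using that by (simp add: omega01_def fls_nth_correlator[OF \<iota> w that] p_def h_def)
  qed
  have mult: "E (fps_const (p m) * fps_X ^ m) = E (fps_const (p m)) * E fps_X ^ m" for m
    by (simp add: E_def dexp_mult[OF derivation_Dflow] dexp_power[OF derivation_Dflow])
  have "fps_nth (subst_s \<iota> (time1 (Upsilon h)) (S_series s)) a = eval1 \<iota> s (slice (E Pser) a)"
    using eval_dexp_Ksub[OF \<iota> h0, of s var_s] by (simp add: eval_z_def Upsilon_def E_def Ksub_var_s fps_eq_iff)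
  also have "slice (E Pser) a = (\<Sum>m\<in>{1..a}. slice (E (fps_const (p m)) * E fps_X ^ m) a)"
  proof (rule fps_ext)
    fix n
    have "fps_nth (slice (E Pser) a) n =
        (\<Sum>m\<in>{1..a}. fps_nth (slice (E (fps_const (p m) * fps_X ^ m)) a) n)"
      by (simp add: slice_def E_def dexp_def cfact_def Dflow_iter_Pser sum_distrib_left p_def)
    thus "fps_nth (slice (E Pser) a) n =
        fps_nth (\<Sum>m\<in>{1..a}. slice (E (fps_const (p m)) * E fps_X ^ m) a) n"
      by (simp add: mult fps_sum_nth)
  qed
  also have "eval1 \<iota> s \<dots> = (\<Sum>m\<in>{1..a}. fps_nth (eval_z \<iota> s (E (fps_const (p m)) * E fps_X ^ m)) a)"
  proof -
    have "admissible (slice (E (fps_const (p m)) * E fps_X ^ m) a)" if "m \<in> {1..a}" for m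
      using admissible_z_mult[OF admp[of m] admissible_z_power[OF admX, of m]] that
      by (auto simp: admissible_z_def)
    thus ?thesis unfolding eval_z_def fps_nth_Abs_fps by (rule eval1_sum[OF \<iota>])
  qed
  also have "\<dots> = (\<Sum>m\<in>{1..a}. fps_nth (omega01 \<iota> w s) m * fps_nth (X_curve \<iota> h s ^ m) a)"
    by (intro sum.cong refl) (simp add: eval_z_mult[OF \<iota> admp admissible_z_power[OF admX]]
        eval_z_power[OF \<iota> admX] evp evX)
  \<comment> \<open>The index m = 0 may be added because \<open>omega01\<close> has no constant
    term.\<close>
  also have "\<dots> = fps_nth (omega01 \<iota> w s oo X_curve \<iota> h s) a"
    unfolding fps_compose_nth by (rule sum.mono_neutral_left) (auto simp: omega01_def not_less_eq_eq)
  finally show "fps_nth (omega01 \<iota> w s oo X_curve \<iota> (leading_symbol w) s) a =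
      fps_nth (subst_s \<iota> (time1 (Upsilon (leading_symbol w))) (S_series s)) a"
    by (simp add: h_def)
qed

text \<open>If s divides \<open>h\<close> and \<open>f\<close>, it divides their derivatives in z,
  hence both products in the bracket: the ideal (s) is invariant.\<close>

lemma ham_field_iter_nth_0:
  assumes "fps_nth h 0 = 0" "fps_nth f 0 = 0"
  shows "fps_nth ((ham_field h ^^ n) f) 0 = 0"
  using assms(2)
proof (induction n)
  case (Suc n)
  thus ?case using assms(1) by (simp add: ham_field_def zd_z_def fps_XD_def)
qed simp

text \<open>The powers \<open>0 ^ b\<close> leave only the term \<open>b = 0\<close>, and there the
  coefficient of \<open>f\<close> vanishes.\<close>

lemma subst_s_0:
  assumes "field_embedding \<iota>" "fps_nth f 0 = 0"
  shows "subst_s \<iota> f 0 = 0"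
proof (rule fps_ext)
  fix n
  have "fps_map \<iota> (fps_nth f b) * 0 ^ b = 0" for b
    using assms by (cases b) (auto intro!: fps_ext simp: fps_map_def emb_0)
  thus "fps_nth (subst_s \<iota> f 0) n = fps_nth 0 n"
    unfolding subst_s_def fps_nth_Abs_fps by (simp only:) simp
qed

theorem proposition5p7:
  fixes w :: "nat \<Rightarrow> nat \<Rightarrow> complex fls"
    and \<iota> :: "complex \<Rightarrow> 'k::field"
    and s :: "nat \<Rightarrow> 'k"
  assumes "field_embedding \<iota>"
    and "cut_join_symbol w"
    and "var_s dvd leading_symbol w"
    and "time1_exists (Xi (leading_symbol w))"
    and "time1_exists (Upsilon (leading_symbol w))"
  shows "fps_to_fls (omega01 \<iota> w s oo X_curve \<iota> (leading_symbol w) s)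
           * dlog (X_curve \<iota> (leading_symbol w) s)
         = fps_to_fls (y_curve \<iota> (leading_symbol w) s)
           * dlog (X_curve \<iota> (leading_symbol w) s)"
proof -
  have h0: "fps_nth (leading_symbol w) 0 = 0"
    using assms(3) by (auto simp: var_s_def)
  \<comment> \<open>This is Upsilon_1(z, 0) = 0, from the invariance of the ideal (s) applied to the
    coordinate s.\<close>
  have "fps_nth (time1 (Upsilon (leading_symbol w))) 0 = 0"
    using ham_field_iter_nth_0[OF h0, of var_s]
    by (intro fps_ext) (simp add: Upsilon_def fps_nth_time1_flow var_s_def)
  hence "y_curve \<iota> (leading_symbol w) s = subst_s \<iota> (time1 (Upsilon (leading_symbol w))) (S_series s)"
    by (simp add: y_curve_def subst_s_0[OF assms(1)])
  thus ?thesis by (simp add: omega01_compose[OF assms(1,2) h0])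
qed

end
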